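(* Let $M$ be a manifold with complementary distributions $D$ and $D^\perp$, and let $g_t$ be a $D$-conformal family of Riemannian metrics on $M$ for which $D$ and $D^\perp$ are orthogonal, i.e. $\partial_t g_t=s_t\,\hat g_t$ with $s_t:M\to\mathbb R$. If $D$ is umbilical for $g_0$, then $D$ is umbilical for any $g_t$.
   Context: Metrics and their dependence on $t$ are smooth. For a metric $g$ making $D$ and $D^\perp$ orthogonal, $\hat g$ is the $D$-truncated metric: $\hat g(X,Y)=g(X,Y)$ for $X,Y\in D$ and $\hat g(\xi,\cdot)=0$ for $\xi\in D^\perp$. With $n=\dim D$, the second fundamental tensor of $D$ is $b(X,Y)=\frac12(\nabla_XY+\nabla_YX)^\perp$ for $X,Y\in D$ ($\nabla$ the Levi-Civita connection of $g$, $(\cdot)^\perp$ the $D^\perp$-component), its mean curvature vector is $H=\operatorname{tr}_g b\in\Gamma(D^\perp)$, and $D$ is umbilical for $g$ if $n\,b=H\cdot g_{|D}$. *)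

theory Defs
  imports "HOL-Analysis.Analysis"
begin

text \<open>For open \<open>U\<close>, \<open>ck k U f\<close> says that \<open>f\<close> is of class \<open>C\<^sup>k\<close> on \<open>U\<close>.\<close>

fun ck :: "nat \<Rightarrow> 'a::euclidean_space set \<Rightarrow> ('a \<Rightarrow> 'b::real_normed_vector) \<Rightarrow> bool" where
  "ck 0 U f \<longleftrightarrow> continuous_on U f"
| "ck (Suc k) U f \<longleftrightarrow>
     (\<forall>x\<in>U. f differentiable (at x)) \<and> (\<forall>v. ck k U (\<lambda>x. frechet_derivative f (at x) v))"

text \<open>On an arbitrary set \<open>S\<close>, smoothness means that \<open>f\<close> locally extends to a smooth map on an
  open set. This is needed for time-dependent functions on \<open>I \<times> U\<close> with \<open>I\<close> a possibly non-open
  interval; for open \<open>S\<close> it is ordinary smoothness.\<close>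

definition smooth_on :: "'a::euclidean_space set \<Rightarrow> ('a \<Rightarrow> 'b::real_normed_vector) \<Rightarrow> bool" where
  "smooth_on S f \<longleftrightarrow>
     (\<forall>x\<in>S. \<exists>U h. open U \<and> x \<in> U \<and> (\<forall>k. ck k U h) \<and> (\<forall>y\<in>S \<inter> U. h y = f y))"

text \<open>The manifold is the whole type \<open>'m\<close>, with a smooth atlas of charts \<open>(U, \<phi>)\<close> in the
  Euclidean space \<open>'e\<close>; \<open>\<phi>\<close> is only relevant on \<open>U\<close>.\<close>

type_synonym ('m, 'e) atlas = "('m set \<times> ('m \<Rightarrow> 'e)) set"

definition smooth_atlas ::
    "('m::{t2_space, second_countable_topology}, 'e::euclidean_space) atlas \<Rightarrow> bool" where
  "smooth_atlas A \<longleftrightarrow>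
     (\<forall>(U, \<phi>)\<in>A. open U \<and> open (\<phi> ` U) \<and> homeomorphism U (\<phi> ` U) \<phi> (inv_into U \<phi>)) \<and>
     (\<Union>(U, \<phi>)\<in>A. U) = UNIV \<and>
     (\<forall>(U, \<phi>)\<in>A. \<forall>(V, \<psi>)\<in>A. smooth_on (\<phi> ` (U \<inter> V)) (\<psi> \<circ> inv_into U \<phi>))"

definition smooth_fun ::
    "('m::{t2_space, second_countable_topology}, 'e::euclidean_space) atlas \<Rightarrow> 'm set \<Rightarrow>
     ('m \<Rightarrow> real) \<Rightarrow> bool" where
  "smooth_fun A W f \<longleftrightarrow> (\<forall>(U, \<phi>)\<in>A. smooth_on (\<phi> ` (U \<inter> W)) (f \<circ> inv_into U \<phi>))"

definition smooth_time_fun ::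
    "('m::{t2_space, second_countable_topology}, 'e::euclidean_space) atlas \<Rightarrow> real set \<Rightarrow>
     (real \<Rightarrow> 'm \<Rightarrow> real) \<Rightarrow> bool" where
  "smooth_time_fun A I f \<longleftrightarrow>
     (\<forall>(U, \<phi>)\<in>A. smooth_on (I \<times> \<phi> ` U) (\<lambda>(t, x). f t (inv_into U \<phi> x)))"

text \<open>Real functionals on functions, as a separate type so that it can be made a real vector
  space. Tangent vectors are those functionals that are derivations of the algebra of smooth
  functions at a point.\<close>

typedef 'm functional = "UNIV :: (('m \<Rightarrow> real) \<Rightarrow> real) set"
  morphisms app Functional ..

setup_lifting type_definition_functional

instantiation functional :: (type) real_vector
begin

lift_definition zero_functional :: "'m functional" is "\<lambda>f. 0" .
lift_definition plus_functional :: "'m functional \<Rightarrow> 'm functional \<Rightarrow> 'm functional"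
  is "\<lambda>v w f. v f + w f" .
lift_definition minus_functional :: "'m functional \<Rightarrow> 'm functional \<Rightarrow> 'm functional"
  is "\<lambda>v w f. v f - w f" .
lift_definition uminus_functional :: "'m functional \<Rightarrow> 'm functional"
  is "\<lambda>v f. - v f" .
lift_definition scaleR_functional :: "real \<Rightarrow> 'm functional \<Rightarrow> 'm functional"
  is "\<lambda>c v f. c * v f" .

instance
  by standard (transfer; auto simp: algebra_simps)+

end

text \<open>Functionals in \<open>tangent_space A p\<close> vanish on non-smooth functions, so that they are
  determined by their values on smooth functions.\<close>

definition tangent_space ::
    "('m::{t2_space, second_countable_topology}, 'e::euclidean_space) atlas \<Rightarrow> 'm \<Rightarrow>
     'm functional set" where
  "tangent_space A p = {v.
     (\<forall>f g. smooth_fun A UNIV f \<longrightarrow> smooth_fun A UNIV g \<longrightarrow>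
        app v (\<lambda>q. f q + g q) = app v f + app v g \<and>
        app v (\<lambda>q. f q * g q) = f p * app v g + g p * app v f) \<and>
     (\<forall>c f. smooth_fun A UNIV f \<longrightarrow> app v (\<lambda>q. c * f q) = c * app v f) \<and>
     (\<forall>f. \<not> smooth_fun A UNIV f \<longrightarrow> app v f = 0)}"

type_synonym 'm vector_field = "'m \<Rightarrow> 'm functional"

definition deriv_along :: "'m vector_field \<Rightarrow> ('m \<Rightarrow> real) \<Rightarrow> 'm \<Rightarrow> real" where
  "deriv_along X f = (\<lambda>p. app (X p) f)"

definition smooth_vector_field ::
    "('m::{t2_space, second_countable_topology}, 'e::euclidean_space) atlas \<Rightarrow> 'm set \<Rightarrow>
     'm vector_field \<Rightarrow> bool" where
  "smooth_vector_field A W X \<longleftrightarrow>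
     (\<forall>p\<in>W. X p \<in> tangent_space A p) \<and>
     (\<forall>f. smooth_fun A UNIV f \<longrightarrow> smooth_fun A W (deriv_along X f))"

definition vector_fields ::
    "('m::{t2_space, second_countable_topology}, 'e::euclidean_space) atlas \<Rightarrow>
     'm vector_field set" where
  "vector_fields A = {X. smooth_vector_field A UNIV X}"

definition lie_bracket :: "'m vector_field \<Rightarrow> 'm vector_field \<Rightarrow> 'm vector_field" where
  "lie_bracket X Y = (\<lambda>p. Functional
     (\<lambda>f. deriv_along X (deriv_along Y f) p - deriv_along Y (deriv_along X f) p))"

definition distribution ::
    "('m::{t2_space, second_countable_topology}, 'e::euclidean_space) atlas \<Rightarrow> nat \<Rightarrow>
     ('m \<Rightarrow> 'm functional set) \<Rightarrow> bool" where
  "distribution A n D \<longleftrightarrow>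
     (\<forall>p. subspace (D p) \<and> D p \<subseteq> tangent_space A p \<and> dim (D p) = n) \<and>
     (\<forall>p. \<exists>W F. open W \<and> p \<in> W \<and> (\<forall>i<n. smooth_vector_field A W (F i)) \<and>
        (\<forall>q\<in>W. span ((\<lambda>i. F i q) ` {..<n}) = D q))"

definition sections ::
    "('m::{t2_space, second_countable_topology}, 'e::euclidean_space) atlas \<Rightarrow>
     ('m \<Rightarrow> 'm functional set) \<Rightarrow> 'm vector_field set" where
  "sections A D = {X \<in> vector_fields A. \<forall>p. X p \<in> D p}"

definition complementary ::
    "('m::{t2_space, second_countable_topology}, 'e::euclidean_space) atlas \<Rightarrow>
     ('m \<Rightarrow> 'm functional set) \<Rightarrow> ('m \<Rightarrow> 'm functional set) \<Rightarrow> bool" where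
  "complementary A D E \<longleftrightarrow>
     (\<forall>p. D p \<inter> E p = {0} \<and> {u + v |u v. u \<in> D p \<and> v \<in> E p} = tangent_space A p)"

text \<open>The component in \<open>P\<close> of a vector of \<open>P \<oplus> Q\<close>.\<close>

definition component :: "'v::real_vector set \<Rightarrow> 'v set \<Rightarrow> 'v \<Rightarrow> 'v" where
  "component P Q v = (THE u. u \<in> P \<and> v - u \<in> Q)"

type_synonym 'm metric = "'m \<Rightarrow> 'm functional \<Rightarrow> 'm functional \<Rightarrow> real"

definition riemannian_metric ::
    "('m::{t2_space, second_countable_topology}, 'e::euclidean_space) atlas \<Rightarrow> 'm metric \<Rightarrow>
     bool" where
  "riemannian_metric A g \<longleftrightarrow>
     (\<forall>p. \<forall>u\<in>tangent_space A p. \<forall>v\<in>tangent_space A p. \<forall>w\<in>tangent_space A p. \<forall>c.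
        g p (u + v) w = g p u w + g p v w \<and> g p (c *\<^sub>R u) w = c * g p u w \<and>
        g p u v = g p v u \<and> (u \<noteq> 0 \<longrightarrow> g p u u > 0)) \<and>
     (\<forall>X\<in>vector_fields A. \<forall>Y\<in>vector_fields A. smooth_fun A UNIV (\<lambda>p. g p (X p) (Y p)))"

definition smooth_metric_family ::
    "('m::{t2_space, second_countable_topology}, 'e::euclidean_space) atlas \<Rightarrow> real set \<Rightarrow>
     (real \<Rightarrow> 'm metric) \<Rightarrow> bool" where
  "smooth_metric_family A I g \<longleftrightarrow>
     (\<forall>t\<in>I. riemannian_metric A (g t)) \<and>
     (\<forall>X\<in>vector_fields A. \<forall>Y\<in>vector_fields A. smooth_time_fun A I (\<lambda>t p. g t p (X p) (Y p)))"

definition orthogonal_distributions ::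
    "'m metric \<Rightarrow> ('m \<Rightarrow> 'm functional set) \<Rightarrow> ('m \<Rightarrow> 'm functional set) \<Rightarrow> bool" where
  "orthogonal_distributions g D E \<longleftrightarrow> (\<forall>p. \<forall>u\<in>D p. \<forall>v\<in>E p. g p u v = 0)"

text \<open>The symmetric bilinear form that agrees with \<open>g\<close> on \<open>D\<close> and vanishes as soon as one argument
  is in the complement \<open>E\<close>.\<close>

definition truncated_metric ::
    "('m \<Rightarrow> 'm functional set) \<Rightarrow> ('m \<Rightarrow> 'm functional set) \<Rightarrow> 'm metric \<Rightarrow> 'm metric" where
  "truncated_metric D E g =
     (\<lambda>p u v. g p (component (D p) (E p) u) (component (D p) (E p) v))"

definition conformal_family ::
    "('m::{t2_space, second_countable_topology}, 'e::euclidean_space) atlas \<Rightarrow>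
     ('m \<Rightarrow> 'm functional set) \<Rightarrow> ('m \<Rightarrow> 'm functional set) \<Rightarrow> real set \<Rightarrow>
     (real \<Rightarrow> 'm metric) \<Rightarrow> (real \<Rightarrow> 'm \<Rightarrow> real) \<Rightarrow> bool" where
  "conformal_family A D E I g s \<longleftrightarrow>
     (\<forall>t\<in>I. \<forall>p. \<forall>u\<in>tangent_space A p. \<forall>v\<in>tangent_space A p.
        ((\<lambda>\<tau>. g \<tau> p u v) has_real_derivative s t p * truncated_metric D E (g t) p u v)
          (at t within I))"

type_synonym 'm connection = "'m vector_field \<Rightarrow> 'm vector_field \<Rightarrow> 'm vector_field"

definition affine_connection ::
    "('m::{t2_space, second_countable_topology}, 'e::euclidean_space) atlas \<Rightarrow> 'm connection \<Rightarrow>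
     bool" where
  "affine_connection A nabla \<longleftrightarrow>
     (\<forall>X\<in>vector_fields A. \<forall>Y\<in>vector_fields A.
        nabla X Y \<in> vector_fields A \<and>
        (\<forall>Z\<in>vector_fields A.
           nabla (\<lambda>p. X p + Z p) Y = (\<lambda>p. nabla X Y p + nabla Z Y p) \<and>
           nabla X (\<lambda>p. Y p + Z p) = (\<lambda>p. nabla X Y p + nabla X Z p)) \<and>
        (\<forall>f. smooth_fun A UNIV f \<longrightarrow>
           nabla (\<lambda>p. f p *\<^sub>R X p) Y = (\<lambda>p. f p *\<^sub>R nabla X Y p) \<and>
           nabla X (\<lambda>p. f p *\<^sub>R Y p) =
             (\<lambda>p. deriv_along X f p *\<^sub>R Y p + f p *\<^sub>R nabla X Y p)))"

definition levi_civita_connection ::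
    "('m::{t2_space, second_countable_topology}, 'e::euclidean_space) atlas \<Rightarrow> 'm metric \<Rightarrow>
     'm connection \<Rightarrow> bool" where
  "levi_civita_connection A g nabla \<longleftrightarrow>
     affine_connection A nabla \<and>
     (\<forall>X\<in>vector_fields A. \<forall>Y\<in>vector_fields A.
        (\<lambda>p. nabla X Y p - nabla Y X p) = lie_bracket X Y) \<and>
     (\<forall>X\<in>vector_fields A. \<forall>Y\<in>vector_fields A. \<forall>Z\<in>vector_fields A.
        deriv_along X (\<lambda>p. g p (Y p) (Z p)) =
          (\<lambda>p. g p (nabla X Y p) (Z p) + g p (Y p) (nabla X Z p)))"

definition second_fundamental_tensor ::
    "('m \<Rightarrow> 'm functional set) \<Rightarrow> ('m \<Rightarrow> 'm functional set) \<Rightarrow> 'm connection \<Rightarrow>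
     'm vector_field \<Rightarrow> 'm vector_field \<Rightarrow> 'm vector_field" where
  "second_fundamental_tensor D E nabla X Y =
     (\<lambda>p. (1/2) *\<^sub>R component (E p) (D p) (nabla X Y p + nabla Y X p))"

text \<open>The trace at \<open>p\<close> is the sum of \<open>b(F\<^sub>i, F\<^sub>i)\<close> for any sections \<open>F\<^sub>0, \<dots>, F\<^sub>n\<^sub>-\<^sub>1\<close> of \<open>D\<close>, where
  \<open>n = dim D\<close>, that are orthonormal at \<open>p\<close>; by tensoriality the choice does not matter.\<close>

definition mean_curvature_vector ::
    "('m::{t2_space, second_countable_topology}, 'e::euclidean_space) atlas \<Rightarrow>
     ('m \<Rightarrow> 'm functional set) \<Rightarrow> ('m \<Rightarrow> 'm functional set) \<Rightarrow> 'm metric \<Rightarrow> 'm connection \<Rightarrow>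
     'm vector_field" where
  "mean_curvature_vector A D E g nabla = (\<lambda>p. THE h. \<forall>F :: nat \<Rightarrow> 'm vector_field.
     (\<forall>i<dim (D p). F i \<in> sections A D) \<and>
     (\<forall>i<dim (D p). \<forall>j<dim (D p). g p (F i p) (F j p) = (if i = j then 1 else 0)) \<longrightarrow>
     h = (\<Sum>i<dim (D p). second_fundamental_tensor D E nabla (F i) (F i) p))"

definition umbilical ::
    "('m::{t2_space, second_countable_topology}, 'e::euclidean_space) atlas \<Rightarrow>
     ('m \<Rightarrow> 'm functional set) \<Rightarrow> ('m \<Rightarrow> 'm functional set) \<Rightarrow> 'm metric \<Rightarrow> 'm connection \<Rightarrow>
     bool" where
  "umbilical A D E g nabla \<longleftrightarrow>
     (\<forall>X\<in>sections A D. \<forall>Y\<in>sections A D. \<forall>p.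
        real (dim (D p)) *\<^sub>R second_fundamental_tensor D E nabla X Y p =
        g p (X p) (Y p) *\<^sub>R mean_curvature_vector A D E g nabla p)"

end

theory Submission
  imports Defs
begin

text \<open>
  Write \<open>E\<close> for the complement \<open>D\<^sup>\<bottom>\<close>. For sections \<open>X, Y\<close> of \<open>D\<close> and \<open>Z\<close> of \<open>E\<close>, the product rule for
  the metric and the vanishing torsion turn the second fundamental tensor into a Lie derivative:
  \<open>2 g(b(X,Y), Z) = -(L\<^sub>Z g)(X,Y)\<close>, where \<open>(L\<^sub>Z g)(X,Y) = Z(g(X,Y)) + g(Y,[X,Z]) + g(X,[Y,Z])\<close>
  (\<open>second_fundamental_eq_lie_derivative\<close>). So \<open>D\<close> is umbilical exactly when, for every \<open>Z\<close>, the
  restriction of \<open>L\<^sub>Z g\<close> to \<open>D\<close> is a multiple of the restriction of \<open>g\<close>. The formula for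
  \<open>L\<^sub>Z g\<close> involves the metric only through its values \<open>g(u,v)\<close> with \<open>u\<close> in \<open>D\<close>.

  For \<open>u\<close> in \<open>D\<close> and any tangent vector \<open>v\<close>, orthogonality gives that the truncated metric and the
  metric agree on \<open>(u,v)\<close>, so \<open>\<partial>\<^sub>t g\<^sub>t(u,v) = s\<^sub>t g\<^sub>t(u,v)\<close>. All these functions of \<open>t\<close> solve the same
  linear equation, hence their quotients are constant: at each point \<open>g\<^sub>t(u,v) = \<rho> g\<^sub>0(u,v)\<close> with a
  factor \<open>\<rho>\<close> independent of \<open>u\<close> and \<open>v\<close> (\<open>conformal_family_ratio_constant\<close>). Since
  \<open>L\<^sub>Z (\<rho> g) = \<rho> L\<^sub>Z g + Z(\<rho>) g\<close>, being a multiple of the metric on \<open>D\<close> is inherited by \<open>g\<^sub>t\<close>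
  (\<open>umbilical_transfer\<close>).

  The factor \<open>\<rho>\<close> is a quotient \<open>g\<^sub>t(W,W) / g\<^sub>0(W,W)\<close>, which makes sense only where the section \<open>W\<close>
  does not vanish, and \<open>D\<close> may have no section without zeros. The proof therefore uses the
  cross-multiplied identity \<open>g\<^sub>t(X,Y) g\<^sub>0(W,W) = g\<^sub>0(X,Y) g\<^sub>t(W,W)\<close>, which holds between globally
  smooth functions and can be differentiated along \<open>Z\<close>. In the same spirit umbilicity is expressed
  without the mean curvature vector, by \<open>g(W,W) b(X,Y) = g(X,Y) b(W,W)\<close>
  (\<open>umbilical_iff_proportional\<close>).

  Both this reformulation and the test against all \<open>Z\<close> need enough global sections: every vector of
  \<open>D\<close> or \<open>E\<close> at a point is the value of one (\<open>section_through\<close>). A distribution only comes with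
  local frames, so these are cut off by bump functions, and this is where the calculus of the
  predicate \<open>ck\<close> is needed.
\<close>

section \<open>Calculus of functions of class C^k\<close>

lemma ck_subset: "ck k U f \<Longrightarrow> V \<subseteq> U \<Longrightarrow> ck k V f"
  by (induction k arbitrary: f) (auto intro: continuous_on_subset)

lemma ck_cong:
  assumes "open U" "\<And>x. x \<in> U \<Longrightarrow> f x = g x" "ck k U f"
  shows "ck k U g"
  using assms(2,3)
proof (induction k arbitrary: f g)
  case 0
  then show ?case by (auto cong: continuous_on_cong)
next
  case (Suc k)
  have d: "g differentiable (at x)" "frechet_derivative f (at x) = frechet_derivative g (at x)"
    if "x \<in> U" for x
  proof -
    have "(f has_derivative frechet_derivative f (at x)) (at x)"
      using Suc.prems that frechet_derivative_works by auto
    then have g: "(g has_derivative frechet_derivative f (at x)) (at x)"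
      using has_derivative_transform_within_open[OF _ assms(1) that] Suc.prems(1) by blast
    then show "g differentiable (at x)" by (auto simp: differentiable_def)
    show "frechet_derivative f (at x) = frechet_derivative g (at x)"
      by (rule frechet_derivative_at[OF g])
  qed
  have "ck k U (\<lambda>x. frechet_derivative g (at x) v)" for v
    by (rule Suc.IH[of "\<lambda>x. frechet_derivative f (at x) v"]) (use d Suc.prems in auto)
  then show ?case using d by auto
qed

text \<open>Differentiability of the derivative can be checked on any formula \<open>f'\<close> for it; openness of \<open>U\<close>
  makes agreement on \<open>U\<close> enough.\<close>

lemma ck_SucI:
  assumes "open U" "\<And>x. x \<in> U \<Longrightarrow> (f has_derivative f' x) (at x)" "\<And>v. ck k U (\<lambda>x. f' x v)"
  shows "ck (Suc k) U f"
proof -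
  have "ck k U (\<lambda>x. frechet_derivative f (at x) v)" for v
  proof (rule ck_cong[OF assms(1) _ assms(3)])
    show "f' x v = frechet_derivative f (at x) v" if "x \<in> U" for x
      using frechet_derivative_at[OF assms(2)[OF that]] by simp
  qed
  then show ?thesis using assms(2) by (auto simp: differentiable_def)
qed

lemma ck_Suc_has_derivative:
  "ck (Suc k) U f \<Longrightarrow> x \<in> U \<Longrightarrow> (f has_derivative frechet_derivative f (at x)) (at x)"
  by (simp add: frechet_derivative_works)

lemma ck_Suc_imp_ck: "ck (Suc k) U f \<Longrightarrow> ck k U f"
proof (induction k arbitrary: f)
  case 0
  then show ?case
    by (auto intro!: continuous_at_imp_continuous_on differentiable_imp_continuous_within)
next
  case (Suc k)
  show ?case unfolding ck.simps(2)
  proof (intro conjI allI)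
    show "\<forall>x\<in>U. f differentiable (at x)" using Suc.prems by simp
    show "ck k U (\<lambda>x. frechet_derivative f (at x) v)" for v
      by (rule Suc.IH) (use Suc.prems in simp)
  qed
qed

lemma ck_const: "open U \<Longrightarrow> ck k U (\<lambda>x. c)"
proof (induction k arbitrary: c)
  case (Suc k)
  show ?case
    by (rule ck_SucI[OF Suc.prems, where f' = "\<lambda>_ _. 0"]) (auto intro: Suc.IH Suc.prems)
qed simp

lemma ck_bounded_linear:
  assumes "open U" "bounded_linear L"
  shows "ck k U L"
proof (cases k)
  case 0
  then show ?thesis by (simp add: assms(2) linear_continuous_on)
next
  case (Suc j)
  show ?thesis unfolding Suc
    by (rule ck_SucI[OF assms(1), where f' = "\<lambda>_. L"])
      (auto intro: bounded_linear_imp_has_derivative assms(2) ck_const assms(1))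
qed

lemma ck_add:
  assumes "open U"
  shows "ck k U f \<Longrightarrow> ck k U g \<Longrightarrow> ck k U (\<lambda>x. f x + g x)"
proof (induction k arbitrary: f g)
  case (Suc k)
  show ?case
  proof (rule ck_SucI[OF assms])
    show "((\<lambda>x. f x + g x) has_derivative
        (\<lambda>v. frechet_derivative f (at x) v + frechet_derivative g (at x) v)) (at x)"
      if "x \<in> U" for x
      by (intro has_derivative_add Suc.prems[THEN ck_Suc_has_derivative] that)
  qed (use Suc in auto)
qed (simp add: continuous_on_add)

lemma ck_sum:
  assumes "open U" "\<And>i. i \<in> A \<Longrightarrow> ck k U (f i)"
  shows "ck k U (\<lambda>x. \<Sum>i\<in>A. f i x)"
  using assms(2)
  by (induction A rule: infinite_finite_induct) (auto intro: ck_const ck_add assms(1))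

lemma ck_scaleR:
  fixes f :: "'a::euclidean_space \<Rightarrow> real"
  assumes "open U"
  shows "ck k U f \<Longrightarrow> ck k U g \<Longrightarrow> ck k U (\<lambda>x. f x *\<^sub>R g x)"
proof (induction k arbitrary: f g)
  case (Suc k)
  show ?case
  proof (rule ck_SucI[OF assms])
    show "((\<lambda>x. f x *\<^sub>R g x) has_derivative
        (\<lambda>v. f x *\<^sub>R frechet_derivative g (at x) v + frechet_derivative f (at x) v *\<^sub>R g x)) (at x)"
      if "x \<in> U" for x
      by (intro has_derivative_scaleR Suc.prems[THEN ck_Suc_has_derivative] that)
    show "ck k U (\<lambda>x. f x *\<^sub>R frechet_derivative g (at x) v + frechet_derivative f (at x) v *\<^sub>R g x)"
      for v
      by (intro ck_add assms Suc.IH ck_Suc_imp_ck[OF Suc.prems(1)] ck_Suc_imp_ck[OF Suc.prems(2)])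
        (use Suc.prems in auto)
  qed
qed (simp add: continuous_on_scaleR)

lemma ck_compose_bounded_linear:
  assumes "open U" "bounded_linear L"
  shows "ck k U f \<Longrightarrow> ck k U (\<lambda>x. L (f x))"
proof (induction k arbitrary: f)
  case 0
  then show ?case using bounded_linear.continuous_on[OF assms(2)] by auto
next
  case (Suc k)
  show ?case
  proof (rule ck_SucI[OF assms(1)])
    show "((\<lambda>x. L (f x)) has_derivative (\<lambda>v. L (frechet_derivative f (at x) v))) (at x)"
      if "x \<in> U" for x
      by (intro bounded_linear.has_derivative[OF assms(2)] Suc.prems[THEN ck_Suc_has_derivative] that)
  qed (use Suc in auto)
qed

text \<open>The chain rule is expanded in the standard basis, because \<open>ck\<close> speaks of the derivative in a
  fixed direction only, whereas the inner derivative \<open>f'(x) v\<close> varies with \<open>x\<close>.\<close>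

lemma ck_compose:
  fixes f :: "'a::euclidean_space \<Rightarrow> 'b::euclidean_space"
  assumes "open U" "f ` U \<subseteq> V"
  shows "ck k U f \<Longrightarrow> ck k V g \<Longrightarrow> ck k U (\<lambda>x. g (f x))"
proof (induction k arbitrary: g)
  case 0
  then show ?case using continuous_on_compose2 assms(2) by auto
next
  case (Suc k)
  let ?f' = "\<lambda>x. frechet_derivative f (at x)" and ?g' = "\<lambda>y. frechet_derivative g (at y)"
  have g: "(g has_derivative ?g' (f x)) (at (f x))" if "x \<in> U" for x
    by (rule ck_Suc_has_derivative[OF Suc.prems(2)]) (use that assms(2) in auto)
  show ?case
  proof (rule ck_SucI[OF assms(1)])
    show "((\<lambda>x. g (f x)) has_derivative
        (\<lambda>v. \<Sum>b\<in>Basis. (?f' x v \<bullet> b) *\<^sub>R ?g' (f x) b)) (at x)" if "x \<in> U" for x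
    proof -
      have chain: "((\<lambda>x. g (f x)) has_derivative (\<lambda>v. ?g' (f x) (?f' x v))) (at x)"
        using diff_chain_at[OF ck_Suc_has_derivative[OF Suc.prems(1) that] g[OF that]]
        by (simp add: o_def)
      have lin: "linear (?g' (f x))" by (rule has_derivative_linear[OF g[OF that]])
      have "?g' (f x) w = (\<Sum>b\<in>Basis. (w \<bullet> b) *\<^sub>R ?g' (f x) b)" for w
      proof -
        have "?g' (f x) (\<Sum>b\<in>Basis. (w \<bullet> b) *\<^sub>R b) = (\<Sum>b\<in>Basis. (w \<bullet> b) *\<^sub>R ?g' (f x) b)"
          using lin by (simp add: linear_sum linear_scale)
        then show ?thesis by (simp add: euclidean_representation)
      qed
      then show ?thesis by (intro has_derivative_eq_rhs[OF chain] ext)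
    qed
    show "ck k U (\<lambda>x. \<Sum>b\<in>Basis. (?f' x v \<bullet> b) *\<^sub>R ?g' (f x) b)" for v
    proof (rule ck_sum[OF assms(1)], rule ck_scaleR[OF assms(1)])
      show "ck k U (\<lambda>x. ?f' x v \<bullet> b)" for b
        by (rule ck_compose_bounded_linear[OF assms(1) bounded_linear_inner_left,
            of k "\<lambda>x. ?f' x v"]) (use Suc.prems(1) in simp)
      show "ck k U (\<lambda>x. ?g' (f x) b)" for b
        by (rule Suc.IH[OF ck_Suc_imp_ck[OF Suc.prems(1)], of "\<lambda>y. ?g' y b"])
          (use Suc.prems(2) in simp)
    qed
  qed
qed

lemma ck_local:
  "(\<And>x. x \<in> S \<Longrightarrow> \<exists>U. open U \<and> x \<in> U \<and> ck k U f) \<Longrightarrow> ck k S f"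
proof (induction k arbitrary: f)
  case 0
  show ?case unfolding ck.simps
  proof (rule continuous_at_imp_continuous_on, rule ballI)
    fix x assume "x \<in> S"
    then show "isCont f x" using 0 by (metis ck.simps(1) continuous_on_eq_continuous_at)
  qed
next
  case (Suc k)
  have "f differentiable (at x)" if "x \<in> S" for x using Suc.prems[OF that] by auto
  moreover have "ck k S (\<lambda>x. frechet_derivative f (at x) v)" for v
    by (rule Suc.IH) (use Suc.prems in fastforce)
  ultimately show ?case by simp
qed

text \<open>On the intersection of an open set with its neighbourhood, a local extension is the function
  itself; and being \<open>C\<^sup>k\<close> near every point is being \<open>C\<^sup>k\<close>.\<close>

lemma smooth_on_open_iff:
  assumes "open S"
  shows "smooth_on S f \<longleftrightarrow> (\<forall>k. ck k S f)"
proof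
  assume f: "smooth_on S f"
  show "\<forall>k. ck k S f"
  proof (rule allI, rule ck_local)
    fix k x assume x: "x \<in> S"
    from bspec[OF f[unfolded smooth_on_def] x]
    obtain U h where U: "open U" "x \<in> U" "ck k U h" "\<And>y. y \<in> S \<inter> U \<Longrightarrow> h y = f y"
      by auto
    have "ck k (S \<inter> U) f"
      by (rule ck_cong[of _ h]) (use U assms ck_subset[OF U(3)] in auto)
    then show "\<exists>U. open U \<and> x \<in> U \<and> ck k U f"
      using U x assms by (intro exI[of _ "S \<inter> U"]) auto
  qed
next
  assume "\<forall>k. ck k S f"
  then show "smooth_on S f"
    unfolding smooth_on_def using assms by (intro ballI exI[of _ S] exI[of _ f]) auto
qed

section \<open>Bump functions on Euclidean space\<close>

text \<open>The flat function \<open>exp (-1/x)\<close> extended by zero, multiplied by a polynomial in \<open>1/x\<close>: the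
  polynomial makes the family closed under differentiation, so smoothness follows by induction.\<close>

definition exp_cutoff :: "real poly \<Rightarrow> real \<Rightarrow> real" where
  "exp_cutoff P x = (if x > 0 then poly P (1 / x) * exp (- (1 / x)) else 0)"

lemma tendsto_poly_times_exp_minus: "((\<lambda>y. poly P y * exp (- y)) \<longlongrightarrow> (0::real)) at_top"
proof -
  have "((\<lambda>y. \<Sum>i\<le>degree P. coeff P i * (y ^ i / exp y)) \<longlongrightarrow> (\<Sum>i\<le>degree P. coeff P i * 0)) at_top"
    by (intro tendsto_intros tendsto_power_div_exp_0)
  then show ?thesis
    by (simp only: poly_altdef exp_minus sum_distrib_right divide_inverse mult.assoc
        mult_zero_right sum.neutral_const)
qed

lemma tendsto_exp_cutoff_0: "(exp_cutoff P \<longlongrightarrow> 0) (at 0)"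
proof (rule filterlim_split_at)
  have "eventually (\<lambda>x. exp_cutoff P x = 0) (at_left 0)"
    by (auto simp: eventually_at_filter exp_cutoff_def)
  then show "(exp_cutoff P \<longlongrightarrow> 0) (at_left 0)" by (rule tendsto_eventually)
  have "((\<lambda>x. poly P (inverse x) * exp (- inverse x)) \<longlongrightarrow> 0) (at_right 0)"
    by (rule filterlim_compose[OF tendsto_poly_times_exp_minus filterlim_inverse_at_top_right])
  then show "(exp_cutoff P \<longlongrightarrow> 0) (at_right 0)"
    by (rule Lim_transform_eventually)
      (auto simp: eventually_at_filter exp_cutoff_def inverse_eq_divide)
qed

text \<open>At zero the difference quotient is again a function of the family, with the polynomial multiplied
  by the variable, and these all tend to zero.\<close>

lemma has_derivative_exp_cutoff:
  "(exp_cutoff P has_real_derivative exp_cutoff ([:0, 0, 1:] * (P - pderiv P)) x) (at x)"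
proof -
  consider "x > 0" | "x < 0" | "x = 0" by linarith
  then show ?thesis
  proof cases
    case 1
    have d: "((\<lambda>x. 1 / x) has_real_derivative - (1 / x)\<^sup>2) (at x)"
      using 1 by (auto intro!: derivative_eq_intros simp: power2_eq_square)
    have "((\<lambda>x. poly P (1 / x) * exp (- (1 / x))) has_real_derivative
        (1 / x)\<^sup>2 * (poly P (1 / x) - poly (pderiv P) (1 / x)) * exp (- (1 / x))) (at x)"
      by (rule derivative_eq_intros DERIV_chain2[OF poly_DERIV d] d refl)+ (simp add: algebra_simps)
    then have "((\<lambda>x. poly P (1 / x) * exp (- (1 / x))) has_real_derivative
        exp_cutoff ([:0, 0, 1:] * (P - pderiv P)) x) (at x)"
      using 1 by (simp add: exp_cutoff_def power2_eq_square)
    then show ?thesis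
      by (rule has_field_derivative_transform_within_open[of _ _ _ "{0<..}"])
        (use 1 in \<open>auto simp: exp_cutoff_def\<close>)
  next
    case 2
    have "((\<lambda>_. 0) has_real_derivative exp_cutoff ([:0, 0, 1:] * (P - pderiv P)) x) (at x)"
      using 2 by (auto simp: exp_cutoff_def)
    then show ?thesis
      by (rule has_field_derivative_transform_within_open[of _ _ _ "{..<0}"])
        (use 2 in \<open>auto simp: exp_cutoff_def\<close>)
  next
    case 3
    have "(\<lambda>h. (exp_cutoff P (0 + h) - exp_cutoff P 0) / h) = exp_cutoff ([:0, 1:] * P)"
      by (auto simp: exp_cutoff_def)
    then show ?thesis
      using tendsto_exp_cutoff_0[of "[:0, 1:] * P"] 3
      by (simp add: DERIV_def) (simp add: exp_cutoff_def)
  qed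
qed

lemma ck_exp_cutoff: "ck k UNIV (exp_cutoff P)"
proof (induction k arbitrary: P)
  case 0
  show ?case
    using DERIV_isCont[OF has_derivative_exp_cutoff]
    by (auto intro!: continuous_at_imp_continuous_on)
next
  case (Suc k)
  show ?case
  proof (rule ck_SucI)
    show "(exp_cutoff P has_derivative
        (\<lambda>v. v *\<^sub>R exp_cutoff ([:0, 0, 1:] * (P - pderiv P)) x)) (at x)" for x
      using has_derivative_exp_cutoff[of P x]
      by (simp add: has_field_derivative_def mult_commute_abs)
    show "ck k UNIV (\<lambda>x. v *\<^sub>R exp_cutoff ([:0, 0, 1:] * (P - pderiv P)) x)" for v
      by (intro ck_scaleR ck_const Suc.IH) auto
  qed simp
qed

definition bump :: "'a::euclidean_space \<Rightarrow> real \<Rightarrow> 'a \<Rightarrow> real" where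
  "bump c r x = exp_cutoff 1 (r\<^sup>2 - (x - c) \<bullet> (x - c))"

lemma bump_centre: "r > 0 \<Longrightarrow> bump c r c \<noteq> 0"
  by (simp add: bump_def exp_cutoff_def)

lemma bump_outside: "r > 0 \<Longrightarrow> x \<notin> cball c r \<Longrightarrow> bump c r x = 0"
proof -
  assume r: "r > 0" "x \<notin> cball c r"
  then have "r < norm (x - c)" by (simp add: dist_norm norm_minus_commute)
  then have "r\<^sup>2 < (norm (x - c))\<^sup>2" using r by (intro power_strict_mono) auto
  then show ?thesis by (simp add: bump_def exp_cutoff_def power2_norm_eq_inner)
qed

text \<open>The squared distance is smooth because its derivative in each direction is an affine function.\<close>

lemma ck_bump:
  fixes c :: "'a::euclidean_space"
  shows "ck k UNIV (bump c r)"
proof -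
  let ?q = "\<lambda>x. r\<^sup>2 - (x - c) \<bullet> (x - c)"
  have q: "ck k UNIV ?q"
  proof (rule ck_Suc_imp_ck, rule ck_SucI)
    show "(?q has_derivative (\<lambda>v. - (2 * ((x - c) \<bullet> v)))) (at x)" for x
      by (auto intro!: derivative_eq_intros simp: inner_commute)
    have "ck k UNIV (\<lambda>x. (- 2) *\<^sub>R (x \<bullet> v) + 2 * (c \<bullet> v))" for v
      by (intro ck_add ck_scaleR ck_const ck_bounded_linear bounded_linear_inner_left) auto
    then show "ck k UNIV (\<lambda>x. - (2 * ((x - c) \<bullet> v)))" for v
      by (simp add: inner_diff_left algebra_simps)
  qed simp
  have "bump c r = (\<lambda>x. exp_cutoff 1 (?q x))" by (simp add: bump_def fun_eq_iff)
  then show ?thesis using ck_compose[OF open_UNIV _ q ck_exp_cutoff] by simp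
qed

section \<open>Smooth functions and sections on a manifold\<close>

lemma open_chart_image:
  assumes "smooth_atlas A" "(U, \<phi>) \<in> A" "open W"
  shows "open (\<phi> ` (U \<inter> W))"
proof -
  have "homeomorphism U (\<phi> ` U) \<phi> (inv_into U \<phi>)" "open (\<phi> ` U)"
    using assms unfolding smooth_atlas_def by auto
  moreover have "openin (top_of_set U) (U \<inter> W)" using assms(3) by auto
  ultimately show ?thesis
    by (metis homeomorphism_imp_open_map openin_open_trans)
qed

lemma chart_inverse:
  assumes "smooth_atlas A" "(U, \<phi>) \<in> A" "q \<in> U"
  shows "inv_into U \<phi> (\<phi> q) = q"
proof -
  have "homeomorphism U (\<phi> ` U) \<phi> (inv_into U \<phi>)"
    using assms unfolding smooth_atlas_def by auto
  then show ?thesis using assms(3) by (simp add: homeomorphism_def)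
qed

lemma smooth_fun_iff:
  assumes "smooth_atlas A" "open W"
  shows "smooth_fun A W f \<longleftrightarrow>
    (\<forall>(U, \<phi>)\<in>A. \<forall>k. ck k (\<phi> ` (U \<inter> W)) (f \<circ> inv_into U \<phi>))"
proof -
  have "smooth_on (\<phi> ` (U \<inter> W)) (f \<circ> inv_into U \<phi>) \<longleftrightarrow>
      (\<forall>k. ck k (\<phi> ` (U \<inter> W)) (f \<circ> inv_into U \<phi>))" if "(U, \<phi>) \<in> A" for U \<phi>
    by (rule smooth_on_open_iff[OF open_chart_image[OF assms(1) that assms(2)]])
  then show ?thesis unfolding smooth_fun_def by blast
qed

lemma smooth_fun_subset:
  assumes "smooth_atlas A" "open W" "open V" "V \<subseteq> W" "smooth_fun A W f"
  shows "smooth_fun A V f"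
proof -
  have "ck k (\<phi> ` (U \<inter> V)) (f \<circ> inv_into U \<phi>)" if "(U, \<phi>) \<in> A" for U \<phi> k
  proof (rule ck_subset)
    show "ck k (\<phi> ` (U \<inter> W)) (f \<circ> inv_into U \<phi>)"
      using assms(5) that unfolding smooth_fun_iff[OF assms(1,2)] by blast
  qed (use assms(4) in auto)
  then show ?thesis unfolding smooth_fun_iff[OF assms(1,3)] by blast
qed

lemma smooth_fun_cong:
  assumes "smooth_atlas A" "open W" "\<And>q. q \<in> W \<Longrightarrow> f q = h q" "smooth_fun A W f"
  shows "smooth_fun A W h"
proof -
  have "ck k (\<phi> ` (U \<inter> W)) (h \<circ> inv_into U \<phi>)" if U: "(U, \<phi>) \<in> A" for U \<phi> k
  proof (rule ck_cong)
    show "open (\<phi> ` (U \<inter> W))" by (rule open_chart_image[OF assms(1) U assms(2)])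
    show "ck k (\<phi> ` (U \<inter> W)) (f \<circ> inv_into U \<phi>)"
      using assms(4) U unfolding smooth_fun_iff[OF assms(1,2)] by blast
    show "(f \<circ> inv_into U \<phi>) x = (h \<circ> inv_into U \<phi>) x" if "x \<in> \<phi> ` (U \<inter> W)" for x
      using that by (auto simp: chart_inverse[OF assms(1) U] assms(3))
  qed
  then show ?thesis unfolding smooth_fun_iff[OF assms(1,2)] by blast
qed

lemma smooth_fun_local:
  assumes "smooth_atlas A" "\<And>p. \<exists>W. open W \<and> p \<in> W \<and> smooth_fun A W f"
  shows "smooth_fun A UNIV f"
proof -
  have "ck k (\<phi> ` (U \<inter> UNIV)) (f \<circ> inv_into U \<phi>)" if U: "(U, \<phi>) \<in> A" for U \<phi> k
  proof (rule ck_local)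
    fix x assume "x \<in> \<phi> ` (U \<inter> UNIV)"
    then obtain q where q: "q \<in> U" "x = \<phi> q" by auto
    obtain W where W: "open W" "q \<in> W" "smooth_fun A W f" using assms(2) by blast
    have "ck k (\<phi> ` (U \<inter> W)) (f \<circ> inv_into U \<phi>)"
      using W(3) U unfolding smooth_fun_iff[OF assms(1) W(1)] by blast
    then show "\<exists>V. open V \<and> x \<in> V \<and> ck k V (f \<circ> inv_into U \<phi>)"
      using open_chart_image[OF assms(1) U W(1)] q W(2)
      by (intro exI[of _ "\<phi> ` (U \<inter> W)"]) auto
  qed
  then show ?thesis unfolding smooth_fun_iff[OF assms(1) open_UNIV] by blast
qed

lemma smooth_fun_const: "smooth_atlas A \<Longrightarrow> open W \<Longrightarrow> smooth_fun A W (\<lambda>_. c)"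
  by (auto simp: smooth_fun_iff o_def intro!: ck_const open_chart_image)

lemma smooth_fun_add:
  assumes "smooth_atlas A" "open W" "smooth_fun A W f" "smooth_fun A W h"
  shows "smooth_fun A W (\<lambda>q. f q + h q)"
  using assms(3,4) unfolding smooth_fun_iff[OF assms(1,2)]
  by (fastforce simp: o_def intro!: ck_add open_chart_image[OF assms(1) _ assms(2)])

lemma smooth_fun_mult:
  assumes "smooth_atlas A" "open W" "smooth_fun A W f" "smooth_fun A W h"
  shows "smooth_fun A W (\<lambda>q. f q * h q)"
proof -
  have "ck k (\<phi> ` (U \<inter> W)) ((\<lambda>q. f q * h q) \<circ> inv_into U \<phi>)" if U: "(U, \<phi>) \<in> A" for U \<phi> k
  proof -
    have "ck k (\<phi> ` (U \<inter> W)) (f \<circ> inv_into U \<phi>)" "ck k (\<phi> ` (U \<inter> W)) (h \<circ> inv_into U \<phi>)"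
      using assms(3,4) U unfolding smooth_fun_iff[OF assms(1,2)] by blast+
    from ck_scaleR[OF open_chart_image[OF assms(1) U assms(2)] this]
    show ?thesis by (simp add: o_def)
  qed
  then show ?thesis unfolding smooth_fun_iff[OF assms(1,2)] by blast
qed

lemma smooth_fun_chart_compose:
  assumes "smooth_atlas A" "(U, \<phi>) \<in> A" "\<And>k. ck k UNIV h"
  shows "smooth_fun A U (h \<circ> \<phi>)"
proof -
  have U: "open U" using assms(1,2) unfolding smooth_atlas_def by auto
  have "ck k (\<psi> ` (V \<inter> U)) (h \<circ> \<phi> \<circ> inv_into V \<psi>)" if V: "(V, \<psi>) \<in> A" for V \<psi> k
  proof -
    have o: "open (\<psi> ` (V \<inter> U))" by (rule open_chart_image[OF assms(1) V U])
    have "smooth_on (\<psi> ` (V \<inter> U)) (\<phi> \<circ> inv_into V \<psi>)"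
      using assms(1,2) V unfolding smooth_atlas_def by fast
    then have "ck k (\<psi> ` (V \<inter> U)) (\<phi> \<circ> inv_into V \<psi>)"
      using smooth_on_open_iff[OF o] by blast
    from ck_compose[OF o subset_UNIV this assms(3)] show ?thesis by (simp add: o_def)
  qed
  then show ?thesis unfolding smooth_fun_iff[OF assms(1) U] by blast
qed

text \<open>The closed set \<open>C\<close> is a ball in a chart. It is closed in the whole manifold because it is compact
  and the manifold is Hausdorff; hence extension by zero is smooth.\<close>

lemma exists_bump_function:
  fixes A :: "('m::{t2_space, second_countable_topology}, 'e::euclidean_space) atlas"
  assumes "smooth_atlas A" "open W" "p \<in> W"
  obtains f C where "smooth_fun A UNIV f" "f p \<noteq> 0" "closed C" "C \<subseteq> W" "\<And>q. q \<notin> C \<Longrightarrow> f q = 0"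
proof -
  obtain U \<phi> where U: "(U, \<phi>) \<in> A" "p \<in> U"
    using assms(1) unfolding smooth_atlas_def by blast
  have oU: "open U" and hom: "homeomorphism U (\<phi> ` U) \<phi> (inv_into U \<phi>)"
    using assms(1) U unfolding smooth_atlas_def by auto
  have "open (\<phi> ` (U \<inter> W))" by (rule open_chart_image[OF assms(1) U(1) assms(2)])
  moreover have "\<phi> p \<in> \<phi> ` (U \<inter> W)" using U assms by auto
  ultimately obtain r where r: "r > 0" "cball (\<phi> p) r \<subseteq> \<phi> ` (U \<inter> W)"
    using open_contains_cball by blast
  define C where "C = inv_into U \<phi> ` cball (\<phi> p) r"
  define f where "f q = (if q \<in> U \<inter> W then bump (\<phi> p) r (\<phi> q) else 0)" for q
  have "C \<subseteq> inv_into U \<phi> ` \<phi> ` (U \<inter> W)" unfolding C_def using r(2) by (rule image_mono)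
  also have "\<dots> \<subseteq> U \<inter> W" using chart_inverse[OF assms(1) U(1)] by auto
  finally have CW: "C \<subseteq> U \<inter> W" .
  have "continuous_on (cball (\<phi> p) r) (inv_into U \<phi>)"
    using homeomorphism_cont2[OF hom] r(2) by (auto intro: continuous_on_subset)
  then have C: "closed C"
    unfolding C_def by (intro compact_imp_closed compact_continuous_image compact_cball)
  have zero: "f q = 0" if "q \<notin> C" for q
  proof (cases "q \<in> U \<inter> W")
    case True
    then have "inv_into U \<phi> (\<phi> q) = q" using chart_inverse[OF assms(1) U(1)] by auto
    then have "\<phi> q \<notin> cball (\<phi> p) r" using that unfolding C_def by (metis image_eqI)
    then show ?thesis using bump_outside[OF r(1)] by (auto simp: f_def simp del: mem_cball)
  qed (simp only: f_def if_False)
  have "smooth_fun A UNIV f"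
  proof (rule smooth_fun_local[OF assms(1)])
    fix q
    show "\<exists>V. open V \<and> q \<in> V \<and> smooth_fun A V f"
    proof (cases "q \<in> C")
      case True
      have "smooth_fun A U (bump (\<phi> p) r \<circ> \<phi>)"
        by (rule smooth_fun_chart_compose[OF assms(1) U(1) ck_bump])
      then have "smooth_fun A (U \<inter> W) (bump (\<phi> p) r \<circ> \<phi>)"
        using smooth_fun_subset[OF assms(1) oU] oU assms(2) by blast
      then have "smooth_fun A (U \<inter> W) f"
        by (rule smooth_fun_cong[OF assms(1), rotated 2]) (use oU assms(2) in \<open>auto simp: f_def\<close>)
      then show ?thesis using True CW oU assms(2) by blast
    next
      case False
      have "smooth_fun A (- C) f"
        by (rule smooth_fun_cong[OF assms(1), where f = "\<lambda>_. 0"])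
          (use C zero in \<open>auto intro!: smooth_fun_const assms(1)\<close>)
      then show ?thesis using False C by blast
    qed
  qed
  moreover have "f p \<noteq> 0" using U assms(3) bump_centre[OF r(1)] by (simp add: f_def)
  ultimately show ?thesis using that C CW zero by blast
qed

lemma app_arith [simp]:
  "app (0 :: 'm functional) f = 0"
  "app (u + v) f = app u f + app v f"
  "app (c *\<^sub>R v) f = c * app v f"
  by (transfer; simp)+

lemma subspace_tangent_space: "subspace (tangent_space A p)"
  by (rule subspaceI) (auto simp: tangent_space_def algebra_simps)

lemma tangent_space_zero_fun:
  assumes "smooth_atlas A" "v \<in> tangent_space A p"
  shows "app v (\<lambda>_. 0) = 0"
proof -
  have "smooth_fun A UNIV (\<lambda>_. 0)" using assms(1) by (rule smooth_fun_const) simp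
  then have "app v (\<lambda>_. 0 + 0) = app v (\<lambda>_. 0) + app v (\<lambda>_. 0)"
    using assms(2) unfolding tangent_space_def by blast
  then show ?thesis by simp
qed

lemma tangent_space_mult:
  assumes "v \<in> tangent_space A p" "smooth_fun A UNIV f" "smooth_fun A UNIV h"
  shows "app v (\<lambda>q. f q * h q) = f p * app v h + h p * app v f"
  using assms unfolding tangent_space_def by blast

lemma distributionD:
  assumes "distribution A n D"
  shows "subspace (D p)" "D p \<subseteq> tangent_space A p" "dim (D p) = n"
  using assms unfolding distribution_def by auto

lemma sections_add:
  assumes "smooth_atlas A" "distribution A n D" "X \<in> sections A D" "Y \<in> sections A D"
  shows "(\<lambda>p. X p + Y p) \<in> sections A D"
proof -
  have "deriv_along (\<lambda>p. X p + Y p) f = (\<lambda>p. deriv_along X f p + deriv_along Y f p)" for f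
    by (simp add: deriv_along_def)
  then show ?thesis
    using assms distributionD[OF assms(2)]
    by (auto simp: sections_def vector_fields_def smooth_vector_field_def
        intro: smooth_fun_add subspace_add subspace_tangent_space)
qed

lemma sections_scaleR:
  assumes "smooth_atlas A" "distribution A n D" "X \<in> sections A D"
  shows "(\<lambda>p. c *\<^sub>R X p) \<in> sections A D"
proof -
  have "deriv_along (\<lambda>p. c *\<^sub>R X p) f = (\<lambda>p. c * deriv_along X f p)" for f
    by (simp add: deriv_along_def)
  moreover have "smooth_fun A UNIV f \<Longrightarrow> smooth_fun A UNIV (\<lambda>p. c * f p)" for f
    by (intro smooth_fun_mult smooth_fun_const assms(1) open_UNIV)
  ultimately show ?thesis
    using assms distributionD[OF assms(2)]
    by (auto simp: sections_def vector_fields_def smooth_vector_field_def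
        intro: subspace_scale subspace_tangent_space)
qed

lemma sections_zero:
  assumes "smooth_atlas A" "distribution A n D"
  shows "(\<lambda>p. 0) \<in> sections A D"
  using assms distributionD[OF assms(2)]
  by (auto simp: sections_def vector_fields_def smooth_vector_field_def deriv_along_def
      intro: smooth_fun_const subspace_0 subspace_tangent_space)

text \<open>A local section is multiplied by a bump function and extended by zero. The scalar \<open>c\<close> is the
  value of the bump function at \<open>p\<close>, which is only known to be nonzero.\<close>

lemma local_section_extends:
  assumes A: "smooth_atlas A" and D: "distribution A n D"
    and W: "open W" "p \<in> W"
    and F: "smooth_vector_field A W F" "\<And>q. q \<in> W \<Longrightarrow> F q \<in> D q"
  obtains X c where "X \<in> sections A D" "c \<noteq> 0" "X p = c *\<^sub>R F p"
proof -
  obtain f C where f: "smooth_fun A UNIV f" "f p \<noteq> 0" "closed C" "C \<subseteq> W"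
      "\<And>q. q \<notin> C \<Longrightarrow> f q = 0"
    using exists_bump_function[OF A W] by metis
  define X where "X q = (if q \<in> W then f q *\<^sub>R F q else 0)" for q
  have XD: "X q \<in> D q" for q
    using F(2) distributionD[OF D, of q] by (auto simp: X_def subspace_0 subspace_scale)
  have "smooth_fun A UNIV (deriv_along X h)" if h: "smooth_fun A UNIV h" for h
  proof (rule smooth_fun_local[OF A])
    fix q
    show "\<exists>V. open V \<and> q \<in> V \<and> smooth_fun A V (deriv_along X h)"
    proof (cases "q \<in> C")
      case True
      have "smooth_fun A W (\<lambda>q. f q * deriv_along F h q)"
        using F(1) h smooth_fun_subset[OF A open_UNIV W(1) _ f(1)]
        by (intro smooth_fun_mult A W) (auto simp: smooth_vector_field_def)
      then have "smooth_fun A W (deriv_along X h)"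
        by (rule smooth_fun_cong[OF A W(1), rotated]) (simp add: deriv_along_def X_def)
      then show ?thesis using True f(4) W(1) by blast
    next
      case False
      have "smooth_fun A (- C) (deriv_along X h)"
        by (rule smooth_fun_cong[OF A, where f = "\<lambda>_. 0"])
          (use f in \<open>auto intro!: smooth_fun_const A simp: deriv_along_def X_def\<close>)
      then show ?thesis using False f(3) by blast
    qed
  qed
  then have "X \<in> sections A D"
    using XD distributionD(2)[OF D]
    by (auto simp: sections_def vector_fields_def smooth_vector_field_def)
  then show ?thesis using that f(2) W(2) by (simp add: X_def)
qed

text \<open>The values at \<open>p\<close> of global sections form a subspace, and it contains nonzero multiples of the vectors of
  a local frame, hence the whole fibre.\<close>

lemma section_through:
  assumes A: "smooth_atlas A" and D: "distribution A n D" and v: "v \<in> D p"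
  obtains X where "X \<in> sections A D" "X p = v"
proof -
  let ?S = "(\<lambda>X. X p) ` sections A D"
  obtain W F where W: "open W" "p \<in> W" "\<And>i. i < n \<Longrightarrow> smooth_vector_field A W (F i)"
      "\<And>q. q \<in> W \<Longrightarrow> span ((\<lambda>i. F i q) ` {..<n}) = D q"
    using D unfolding distribution_def by meson
  have S: "subspace ?S"
  proof (rule subspaceI)
    show "0 \<in> ?S" using sections_zero[OF A D] by (auto intro: image_eqI[rotated])
    show "x + y \<in> ?S" if "x \<in> ?S" "y \<in> ?S" for x y
      using that sections_add[OF A D] by (auto intro: image_eqI[rotated])
    show "c *\<^sub>R x \<in> ?S" if "x \<in> ?S" for x c
      using that sections_scaleR[OF A D] by (auto intro: image_eqI[rotated])
  qed
  have "F i p \<in> ?S" if i: "i < n" for i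
  proof -
    have "F i q \<in> D q" if "q \<in> W" for q using W(4)[OF that] i by (auto intro: span_base)
    then obtain X c where "X \<in> sections A D" "c \<noteq> 0" "X p = c *\<^sub>R F i p"
      using local_section_extends[OF A D W(1,2) W(3)[OF i]] by metis
    moreover from this have "F i p = (1 / c) *\<^sub>R X p" by simp
    ultimately show ?thesis using subspace_scale[OF S, of "X p" "1 / c"] by auto
  qed
  then have "span ((\<lambda>i. F i p) ` {..<n}) \<subseteq> ?S" using S by (intro span_minimal) auto
  then show ?thesis using that v W(2,4) by blast
qed

section \<open>Inner products on a subspace\<close>

text \<open>Orthonormal frames are needed in a fibre of a distribution, on which the metric is
  positive definite; on the whole space of functionals it has no meaning.\<close>

locale inner_product_on =
  fixes V :: "'v::real_vector set" and B :: "'v \<Rightarrow> 'v \<Rightarrow> real"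
  assumes subspace: "subspace V"
    and add_left: "\<lbrakk>u \<in> V; v \<in> V; w \<in> V\<rbrakk> \<Longrightarrow> B (u + v) w = B u w + B v w"
    and scale_left: "\<lbrakk>u \<in> V; w \<in> V\<rbrakk> \<Longrightarrow> B (c *\<^sub>R u) w = c * B u w"
    and sym: "\<lbrakk>u \<in> V; v \<in> V\<rbrakk> \<Longrightarrow> B u v = B v u"
    and pos: "\<lbrakk>u \<in> V; u \<noteq> 0\<rbrakk> \<Longrightarrow> B u u > 0"
begin

lemma zero_left: "w \<in> V \<Longrightarrow> B 0 w = 0"
  using scale_left[of w w 0] by simp

lemma diff_left: "\<lbrakk>u \<in> V; v \<in> V; w \<in> V\<rbrakk> \<Longrightarrow> B (u - v) w = B u w - B v w"
  using add_left[of u "(-1) *\<^sub>R v" w] scale_left[of v w "-1"] subspace_scale[OF subspace, of v "-1"]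
  by simp

lemma scale_right: "\<lbrakk>u \<in> V; w \<in> V\<rbrakk> \<Longrightarrow> B w (c *\<^sub>R u) = c * B w u"
  using scale_left[of u w c] sym subspace_scale[OF subspace] by metis

lemma diff_right: "\<lbrakk>u \<in> V; v \<in> V; w \<in> V\<rbrakk> \<Longrightarrow> B w (u - v) = B w u - B w v"
  using diff_left[of u v w] sym subspace_diff[OF subspace] by metis

lemma sum_left:
  "\<lbrakk>finite S; \<And>i. i \<in> S \<Longrightarrow> e i \<in> V; w \<in> V\<rbrakk>
    \<Longrightarrow> B (\<Sum>i\<in>S. c i *\<^sub>R e i) w = (\<Sum>i\<in>S. c i * B (e i) w)"
proof (induction S rule: finite_induct)
  case (insert j S)
  then have "(\<Sum>i\<in>S. c i *\<^sub>R e i) \<in> V" "c j *\<^sub>R e j \<in> V" "e j \<in> V"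
    using subspace by (auto intro: subspace_sum subspace_scale)
  then show ?case using insert by (simp add: add_left scale_left)
qed (simp add: zero_left)

text \<open>Gram and Schmidt: fewer than the dimension many vectors do not span, so a vector outside their
  span can be made orthogonal to them and normalised.\<close>

lemma orthonormal_family_exists:
  assumes "k \<le> dim V"
  shows "\<exists>e. (\<forall>i<k. e i \<in> V) \<and> (\<forall>i<k. \<forall>j<k. B (e i) (e j) = (if i = j then 1 else 0))"
  using assms
proof (induction k)
  case (Suc k)
  then obtain e where e: "\<And>i. i < k \<Longrightarrow> e i \<in> V"
      "\<And>i j. i < k \<Longrightarrow> j < k \<Longrightarrow> B (e i) (e j) = (if i = j then 1 else 0)"
    by auto
  have "\<not> V \<subseteq> span (e ` {..<k})"
  proof
    assume "V \<subseteq> span (e ` {..<k})"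
    then have "dim V \<le> card (e ` {..<k})" by (rule dim_le_card) simp
    also have "\<dots> \<le> k" using card_image_le[of "{..<k}" e] by simp
    finally show False using Suc.prems by simp
  qed
  then obtain v where v: "v \<in> V" "v \<notin> span (e ` {..<k})" by blast
  define u where "u = (\<Sum>i<k. B v (e i) *\<^sub>R e i)"
  define w where "w = v - u"
  have "u \<in> span (e ` {..<k})"
    unfolding u_def by (intro span_sum span_scale span_base) auto
  then have "w \<noteq> 0" using v(2) unfolding w_def by auto
  have u: "u \<in> V" unfolding u_def using e(1) subspace by (auto intro: subspace_sum subspace_scale)
  have w: "w \<in> V" unfolding w_def using v(1) u by (rule subspace_diff[OF subspace])
  have orth: "B w (e j) = 0" if j: "j < k" for j
  proof -
    have "B u (e j) = (\<Sum>i<k. B v (e i) * B (e i) (e j))"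
      unfolding u_def using e(1) j by (intro sum_left) auto
    also have "\<dots> = (\<Sum>i<k. if i = j then B v (e j) else 0)"
      using e(2) j by (intro sum.cong) auto
    also have "\<dots> = B v (e j)" using j by simp
    finally show ?thesis unfolding w_def using diff_left[OF v(1) u e(1)[OF j]] by simp
  qed
  define r where "r = sqrt (B w w)"
  have r: "r > 0" "r * r = B w w" using pos[OF w \<open>w \<noteq> 0\<close>] by (auto simp: r_def)
  define w' where "w' = (1 / r) *\<^sub>R w"
  have w': "w' \<in> V" unfolding w'_def using w subspace by (auto intro: subspace_scale)
  have "B w' (e j) = 0" "B (e j) w' = 0" if "j < k" for j
    using orth[OF that] scale_left[OF w e(1)[OF that], of "1 / r"] sym[OF w' e(1)[OF that]]
    unfolding w'_def by auto
  moreover have "B w' w' = 1"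
    using scale_left[OF w w', of "1 / r"] scale_right[OF w w, of "1 / r"] r(1)
    unfolding w'_def r(2)[symmetric] by simp
  ultimately show ?case using e w'
    by (intro exI[of _ "e(k := w')"]) (auto simp: less_Suc_eq)
qed simp

lemma subset:
  assumes "subspace S" "S \<subseteq> V"
  shows "inner_product_on S B"
proof
  show "B u v = B v u" if "u \<in> S" "v \<in> S" for u v
    by (rule sym) (use assms(2) that in auto)
qed (use assms in \<open>simp_all add: subset_iff add_left scale_left pos\<close>)

end

section \<open>Orthogonal complementary distributions\<close>

lemma riemannian_metric_inner_product_on:
  assumes "riemannian_metric A g"
  shows "inner_product_on (tangent_space A p) (g p)"
proof
  have g: "g p (u + v) w = g p u w + g p v w \<and> g p (c *\<^sub>R u) w = c * g p u w \<and>
        g p u v = g p v u \<and> (u \<noteq> 0 \<longrightarrow> g p u u > 0)"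
    if "u \<in> tangent_space A p" "v \<in> tangent_space A p" "w \<in> tangent_space A p" for u v w c
    using assms that unfolding riemannian_metric_def by blast
  show "g p (u + v) w = g p u w + g p v w"
    if "u \<in> tangent_space A p" "v \<in> tangent_space A p" "w \<in> tangent_space A p" for u v w
    using g that by blast
  show "g p (c *\<^sub>R u) w = c * g p u w"
    if "u \<in> tangent_space A p" "w \<in> tangent_space A p" for u w c
    using g that by blast
  show "g p u v = g p v u" if "u \<in> tangent_space A p" "v \<in> tangent_space A p" for u v
    using g that by blast
  show "g p u u > 0" if "u \<in> tangent_space A p" "u \<noteq> 0" for u
    using g that by blast
qed (rule subspace_tangent_space)

lemma riemannian_metric_smooth:
  assumes "riemannian_metric A g" "X \<in> vector_fields A" "Y \<in> vector_fields A"
  shows "smooth_fun A UNIV (\<lambda>q. g q (X q) (Y q))"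
  using assms by (simp add: riemannian_metric_def)

lemma component_eqI:
  assumes "subspace P" "subspace Q" "P \<inter> Q = {0}" "u \<in> P" "v - u \<in> Q"
  shows "component P Q v = u"
  unfolding component_def
proof (rule the_equality)
  fix u' assume u': "u' \<in> P \<and> v - u' \<in> Q"
  have "u' - u \<in> P" using subspace_diff[OF assms(1)] u' assms(4) by blast
  moreover have "u' - u \<in> Q"
    using subspace_diff[OF assms(2), of "v - u" "v - u'"] u' assms(5) by simp
  ultimately have "u' - u \<in> {0}" unfolding assms(3)[symmetric] by blast
  then show "u' = u" by simp
qed (use assms(4,5) in blast)

locale complementary_distributions =
  fixes A :: "('m::{t2_space, second_countable_topology}, 'e::euclidean_space) atlas"
    and D E :: "'m \<Rightarrow> 'm functional set" and n m :: nat
  assumes atlas: "smooth_atlas A"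
    and D: "distribution A n D" and E: "distribution A m E"
    and compl: "complementary A D E"
begin

lemma disjoint: "D p \<inter> E p = {0}"
  using compl unfolding complementary_def by simp

lemma decompose:
  assumes "v \<in> tangent_space A p"
  obtains x y where "x \<in> D p" "y \<in> E p" "v = x + y"
proof -
  have "{u + v |u v. u \<in> D p \<and> v \<in> E p} = tangent_space A p"
    using compl unfolding complementary_def by simp
  then have "v \<in> {u + v |u v. u \<in> D p \<and> v \<in> E p}" using assms by simp
  then show ?thesis using that by blast
qed

lemma component_E:
  assumes "v \<in> tangent_space A p"
  shows "component (E p) (D p) v \<in> E p" "v - component (E p) (D p) v \<in> D p"
proof -
  obtain x y where xy: "x \<in> D p" "y \<in> E p" "v = x + y"
    using decompose[OF assms] .
  have "component (E p) (D p) v = y"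
    by (rule component_eqI[OF distributionD(1)[OF E] distributionD(1)[OF D]])
      (use xy disjoint in \<open>simp_all add: Int_commute\<close>)
  then show "component (E p) (D p) v \<in> E p" "v - component (E p) (D p) v \<in> D p"
    using xy by auto
qed

lemma component_D:
  assumes "v \<in> tangent_space A p"
  shows "component (D p) (E p) v \<in> D p" "v - component (D p) (E p) v \<in> E p"
proof -
  obtain x y where xy: "x \<in> D p" "y \<in> E p" "v = x + y"
    using decompose[OF assms] .
  have "component (D p) (E p) v = x"
    by (rule component_eqI[OF distributionD(1)[OF D] distributionD(1)[OF E]])
      (use xy disjoint in simp_all)
  then show "component (D p) (E p) v \<in> D p" "v - component (D p) (E p) v \<in> E p"
    using xy by auto
qed

lemma component_D_id: "v \<in> D p \<Longrightarrow> component (D p) (E p) v = v"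
  by (rule component_eqI[OF distributionD(1)[OF D] distributionD(1)[OF E]])
    (simp_all add: disjoint subspace_0[OF distributionD(1)[OF E]])

end

lemma sections_memD:
  assumes "X \<in> sections A D"
  shows "X \<in> vector_fields A" "X p \<in> D p"
  using assms unfolding sections_def by auto

lemma vector_field_tangent: "X \<in> vector_fields A \<Longrightarrow> X p \<in> tangent_space A p"
  unfolding vector_fields_def smooth_vector_field_def by auto

locale orthogonal_splitting = complementary_distributions A D E n m
  for A :: "('m::{t2_space, second_countable_topology}, 'e::euclidean_space) atlas"
    and D E and n m +
  fixes g :: "'m metric"
  assumes metric: "riemannian_metric A g"
    and orth: "orthogonal_distributions g D E"
begin

sublocale inner_product_on "tangent_space A p" "g p" for p
  by (rule riemannian_metric_inner_product_on[OF metric])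

lemma orthogonal: "u \<in> D p \<Longrightarrow> v \<in> E p \<Longrightarrow> g p u v = 0"
  using orth unfolding orthogonal_distributions_def by simp

text \<open>The component of \<open>v\<close> that truncation discards is orthogonal to \<open>u\<close> anyway.\<close>

lemma truncated_metric_D_left:
  assumes "u \<in> D p" "v \<in> tangent_space A p"
  shows "truncated_metric D E g p u v = g p u v"
proof -
  let ?c = "component (D p) (E p) v"
  have "?c \<in> tangent_space A p" "u \<in> tangent_space A p"
    using assms(1) component_D(1)[OF assms(2)] distributionD(2)[OF D] by auto
  then have "g p u (v - ?c) = g p u v - g p u ?c"
    using assms(2) by (intro diff_right)
  moreover have "g p u (v - ?c) = 0"
    by (rule orthogonal[OF assms(1) component_D(2)[OF assms(2)]])
  ultimately show ?thesis by (simp add: truncated_metric_def component_D_id[OF assms(1)])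
qed

text \<open>Vectors of \<open>E\<close> are told apart by pairing with global sections, since one of these passes through
  their difference.\<close>

lemma E_eqI:
  assumes "u \<in> E p" "v \<in> E p" "\<And>Z. Z \<in> sections A E \<Longrightarrow> g p u (Z p) = g p v (Z p)"
  shows "u = v"
proof (rule ccontr)
  assume "u \<noteq> v"
  have uv: "u - v \<in> E p" using subspace_diff[OF distributionD(1)[OF E]] assms by blast
  then obtain Z where Z: "Z \<in> sections A E" "Z p = u - v"
    using section_through[OF atlas E] by blast
  have T: "u \<in> tangent_space A p" "v \<in> tangent_space A p" "u - v \<in> tangent_space A p"
    using assms uv distributionD(2)[OF E] by auto
  have "g p (u - v) (u - v) = g p u (u - v) - g p v (u - v)"
    using T by (intro diff_left)
  then show False using assms(3)[OF Z(1)] Z(2) pos[OF T(3)] \<open>u \<noteq> v\<close> by simp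
qed

end

section \<open>The second fundamental tensor and umbilicity\<close>

locale levi_civita_splitting = orthogonal_splitting +
  fixes nabla
  assumes levi_civita: "levi_civita_connection A g nabla"
begin

abbreviation "b \<equiv> second_fundamental_tensor D E nabla"

lemma nabla_vector_field:
  "X \<in> vector_fields A \<Longrightarrow> Y \<in> vector_fields A \<Longrightarrow> nabla X Y \<in> vector_fields A"
  using levi_civita unfolding levi_civita_connection_def affine_connection_def by blast

lemma nabla_tangent:
  "X \<in> vector_fields A \<Longrightarrow> Y \<in> vector_fields A \<Longrightarrow> nabla X Y p \<in> tangent_space A p"
  by (rule vector_field_tangent[OF nabla_vector_field])

lemma torsion_free:
  assumes "X \<in> vector_fields A" "Y \<in> vector_fields A"
  shows "lie_bracket X Y p = nabla X Y p - nabla Y X p"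
proof -
  have "(\<lambda>p. nabla X Y p - nabla Y X p) = lie_bracket X Y"
    using levi_civita assms unfolding levi_civita_connection_def by blast
  from fun_cong[OF this, of p] show ?thesis by simp
qed

lemma lie_bracket_tangent:
  assumes "X \<in> vector_fields A" "Y \<in> vector_fields A"
  shows "lie_bracket X Y p \<in> tangent_space A p"
  unfolding torsion_free[OF assms]
  by (intro subspace_diff subspace_tangent_space nabla_tangent assms)

lemma metric_compatible:
  assumes "X \<in> vector_fields A" "Y \<in> vector_fields A" "Z \<in> vector_fields A"
  shows "app (X p) (\<lambda>q. g q (Y q) (Z q)) = g p (nabla X Y p) (Z p) + g p (Y p) (nabla X Z p)"
proof -
  have "deriv_along X (\<lambda>p. g p (Y p) (Z p)) =
      (\<lambda>p. g p (nabla X Y p) (Z p) + g p (Y p) (nabla X Z p))"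
    using levi_civita assms unfolding levi_civita_connection_def by blast
  from fun_cong[OF this, of p] show ?thesis by (simp add: deriv_along_def)
qed

lemma second_fundamental_in_E:
  assumes "X \<in> vector_fields A" "Y \<in> vector_fields A"
  shows "b X Y p \<in> E p"
  unfolding second_fundamental_tensor_def
  by (intro subspace_scale distributionD(1)[OF E] component_E(1) subspace_add
      subspace_tangent_space nabla_tangent assms)

text \<open>Taking the \<open>E\<close>-component is invisible to a vector \<open>z\<close> of \<open>E\<close>, because \<open>D\<close> is orthogonal to \<open>z\<close>.\<close>

lemma second_fundamental_pairing:
  assumes X: "X \<in> vector_fields A" and Y: "Y \<in> vector_fields A" and z: "z \<in> E p"
  shows "2 * g p (b X Y p) z = g p (nabla X Y p) z + g p (nabla Y X p) z"
proof -
  let ?v = "nabla X Y p + nabla Y X p"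
  let ?c = "component (E p) (D p) ?v"
  have v: "?v \<in> tangent_space A p"
    by (intro subspace_add subspace_tangent_space nabla_tangent X Y)
  have T: "z \<in> tangent_space A p" "?c \<in> tangent_space A p"
    using z component_E(1)[OF v] distributionD(2)[OF E] by auto
  have "2 * g p (b X Y p) z = g p ?c z"
    using scale_left[OF T(2,1), of "1 / 2"] by (simp add: second_fundamental_tensor_def)
  moreover have "g p (?v - ?c) z = g p ?v z - g p ?c z" by (rule diff_left[OF v T(2,1)])
  moreover have "g p (?v - ?c) z = 0" by (rule orthogonal[OF component_E(2)[OF v] z])
  moreover have "g p ?v z = g p (nabla X Y p) z + g p (nabla Y X p) z"
    by (intro add_left nabla_tangent X Y T)
  ultimately show ?thesis by simp
qed

text \<open>Since \<open>g(Y,Z) = 0\<close>, the product rule gives \<open>g(\<nabla>\<^sub>X Y, Z) = -g(Y, \<nabla>\<^sub>X Z)\<close>, and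
  \<open>\<nabla>\<^sub>X Z = [X,Z] + \<nabla>\<^sub>Z X\<close>. Symmetrising in \<open>X\<close> and \<open>Y\<close>, the terms with \<open>\<nabla>\<^sub>Z\<close> add up to
  \<open>Z(g(X,Y))\<close>. This expresses the tensor through Lie brackets, which do not depend on the metric,
  and values of the metric on pairs with one entry in \<open>D\<close>.\<close>

lemma second_fundamental_eq_lie_derivative:
  assumes "X \<in> sections A D" "Y \<in> sections A D" "Z \<in> sections A E"
  shows "2 * g p (b X Y p) (Z p) =
    - (app (Z p) (\<lambda>q. g q (X q) (Y q)) + g p (Y p) (lie_bracket X Z p) + g p (X p) (lie_bracket Y Z p))"
proof -
  note XYZ = sections_memD[OF assms(1)] sections_memD[OF assms(2)] sections_memD[OF assms(3)]
  have skew: "g p (nabla V W p) (Z p) = - g p (W p) (nabla V Z p)"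
    if "V \<in> sections A D" "W \<in> sections A D" for V W
  proof -
    have "(\<lambda>q. g q (W q) (Z q)) = (\<lambda>_. 0)"
      using orthogonal sections_memD(2)[OF that(2)] XYZ by blast
    then have "app (V p) (\<lambda>q. g q (W q) (Z q)) = 0"
      using tangent_space_zero_fun[OF atlas vector_field_tangent] sections_memD(1)[OF that(1)]
      by metis
    then show ?thesis
      using metric_compatible[OF that[THEN sections_memD(1)] XYZ(5), of p] by linarith
  qed
  have br: "g p (W p) (lie_bracket V Z p) = g p (W p) (nabla V Z p) - g p (nabla Z V p) (W p)"
    if "V \<in> vector_fields A" "W \<in> vector_fields A" for V W
  proof -
    have "g p (W p) (nabla V Z p - nabla Z V p) = g p (W p) (nabla V Z p) - g p (W p) (nabla Z V p)"
      by (intro diff_right nabla_tangent vector_field_tangent that XYZ)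
    moreover have "g p (W p) (nabla Z V p) = g p (nabla Z V p) (W p)"
      by (intro sym nabla_tangent vector_field_tangent that XYZ)
    ultimately show ?thesis by (simp only: torsion_free[OF that(1) XYZ(5)])
  qed
  have "g p (X p) (nabla Z Y p) = g p (nabla Z Y p) (X p)"
    by (intro sym nabla_tangent vector_field_tangent XYZ)
  then show ?thesis
    using second_fundamental_pairing[OF XYZ(1,3) XYZ(6), of p] skew[OF assms(1,2)] skew[OF assms(2,1)]
      br[OF XYZ(1,3)] br[OF XYZ(3,1)] metric_compatible[OF XYZ(5,1,3), of p]
    by linarith
qed

lemma D_trivial: "n = 0 \<Longrightarrow> D p = {0}"
  using D unfolding distribution_def by (metis image_empty lessThan_0 span_empty)

text \<open>The definite description picks \<open>n h\<close>: every orthonormal frame has trace \<open>n h\<close>, and at least one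
  orthonormal frame consists of the values of global sections, so no other vector qualifies.\<close>

lemma mean_curvature_vector_eq:
  assumes h: "\<And>X. X \<in> sections A D \<Longrightarrow> b X X p = g p (X p) (X p) *\<^sub>R h"
  shows "mean_curvature_vector A D E g nabla p = real n *\<^sub>R h"
proof -
  have dim: "dim (D p) = n" by (rule distributionD(3)[OF D])
  interpret Dp: inner_product_on "D p" "g p"
    by (rule subset[OF distributionD(1,2)[OF D]])
  obtain e where e: "\<And>i. i < n \<Longrightarrow> e i \<in> D p"
      "\<And>i j. i < n \<Longrightarrow> j < n \<Longrightarrow> g p (e i) (e j) = (if i = j then 1 else 0)"
    using Dp.orthonormal_family_exists[of n] dim by auto
  have "\<exists>X. X \<in> sections A D \<and> X p = e i" if "i < n" for i
    using section_through[OF atlas D e(1)[OF that]] by blast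
  then obtain F where F: "\<And>i. i < n \<Longrightarrow> F i \<in> sections A D \<and> F i p = e i" by metis
  have trace: "(\<Sum>i<n. b (G i) (G i) p) = real n *\<^sub>R h"
    if "\<forall>i<n. G i \<in> sections A D"
      "\<forall>i<n. \<forall>j<n. g p (G i p) (G j p) = (if i = j then 1 else 0)" for G
  proof -
    have "(\<Sum>i<n. b (G i) (G i) p) = (\<Sum>i<n. h)"
      using that h by (intro sum.cong) auto
    then show ?thesis by (simp add: sum_constant_scaleR)
  qed
  show ?thesis unfolding mean_curvature_vector_def dim
  proof (rule the_equality)
    show "\<forall>G. (\<forall>i<n. G i \<in> sections A D) \<and>
        (\<forall>i<n. \<forall>j<n. g p (G i p) (G j p) = (if i = j then 1 else 0)) \<longrightarrow>
        real n *\<^sub>R h = (\<Sum>i<n. b (G i) (G i) p)"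
      using trace by metis
    show "h' = real n *\<^sub>R h"
      if "\<forall>G. (\<forall>i<n. G i \<in> sections A D) \<and>
        (\<forall>i<n. \<forall>j<n. g p (G i p) (G j p) = (if i = j then 1 else 0)) \<longrightarrow>
        h' = (\<Sum>i<n. b (G i) (G i) p)" for h'
    proof -
      have "h' = (\<Sum>i<n. b (F i) (F i) p)" using that F e(2) by simp
      also have "\<dots> = real n *\<^sub>R h" by (rule trace) (use F e(2) in auto)
      finally show ?thesis .
    qed
  qed
qed

text \<open>Umbilicity at a point says that \<open>b = g h\<close> on \<open>D\<close> for some vector \<open>h\<close>. Inserting any section \<open>W\<close>
  with \<open>W p \<noteq> 0\<close> shows \<open>h = b(W,W) / g(W,W)\<close>, which eliminates \<open>h\<close>; the mean curvature
  vector is then \<open>n h\<close>.\<close>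

lemma umbilical_iff_proportional:
  "umbilical A D E g nabla \<longleftrightarrow>
    (\<forall>X\<in>sections A D. \<forall>Y\<in>sections A D. \<forall>W\<in>sections A D. \<forall>p. W p \<noteq> 0 \<longrightarrow>
      g p (W p) (W p) *\<^sub>R b X Y p = g p (X p) (Y p) *\<^sub>R b W W p)"
proof (intro iffI ballI allI impI)
  fix X Y W p
  assume u: "umbilical A D E g nabla"
    and XYW: "X \<in> sections A D" "Y \<in> sections A D" "W \<in> sections A D" and "W p \<noteq> 0"
  let ?H = "mean_curvature_vector A D E g nabla p"
  have "n \<noteq> 0" using D_trivial[of p] sections_memD(2)[OF XYW(3), of p] \<open>W p \<noteq> 0\<close> by auto
  have H: "real n *\<^sub>R b V V' p = g p (V p) (V' p) *\<^sub>R ?H"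
    if "V \<in> sections A D" "V' \<in> sections A D" for V V'
    using u that distributionD(3)[OF D] unfolding umbilical_def by metis
  have "real n *\<^sub>R (g p (W p) (W p) *\<^sub>R b X Y p) = g p (W p) (W p) *\<^sub>R (real n *\<^sub>R b X Y p)"
    by (simp add: mult.commute)
  also have "\<dots> = g p (X p) (Y p) *\<^sub>R (g p (W p) (W p) *\<^sub>R ?H)"
    using H[OF XYW(1,2)] by (simp add: mult.commute)
  also have "\<dots> = real n *\<^sub>R (g p (X p) (Y p) *\<^sub>R b W W p)"
    using H[OF XYW(3,3), symmetric] by (simp add: mult.commute)
  finally show "g p (W p) (W p) *\<^sub>R b X Y p = g p (X p) (Y p) *\<^sub>R b W W p"
    by (rule scaleR_left_imp_eq[rotated]) (use \<open>n \<noteq> 0\<close> in simp)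
next
  assume proportional: "\<forall>X\<in>sections A D. \<forall>Y\<in>sections A D. \<forall>W\<in>sections A D. \<forall>p. W p \<noteq> 0 \<longrightarrow>
      g p (W p) (W p) *\<^sub>R b X Y p = g p (X p) (Y p) *\<^sub>R b W W p"
  show "umbilical A D E g nabla" unfolding umbilical_def
  proof (intro ballI allI)
    fix X Y p assume XY: "X \<in> sections A D" "Y \<in> sections A D"
    show "real (dim (D p)) *\<^sub>R b X Y p = g p (X p) (Y p) *\<^sub>R mean_curvature_vector A D E g nabla p"
    proof (cases "D p = {0}")
      case True
      have "X p = 0" using sections_memD(2)[OF XY(1), of p] unfolding True by blast
      moreover have "dim (D p) = 0" unfolding True using dim_le_card[of "{0}" "{}"] by simp
      ultimately show ?thesis
        using zero_left[OF vector_field_tangent[OF sections_memD(1)[OF XY(2)]], of p] by simp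
    next
      case False
      moreover have "0 \<in> D p" by (rule subspace_0[OF distributionD(1)[OF D]])
      ultimately obtain w where w: "w \<in> D p" "w \<noteq> 0" by blast
      obtain W where W: "W \<in> sections A D" "W p = w"
        using section_through[OF atlas D w(1)] by blast
      define a where "a = g p w w"
      have a: "a > 0" unfolding a_def using pos[of w p] w distributionD(2)[OF D] by auto
      define h where "h = (1 / a) *\<^sub>R b W W p"
      have h: "b V V' p = g p (V p) (V' p) *\<^sub>R h"
        if "V \<in> sections A D" "V' \<in> sections A D" for V V'
      proof -
        have "a *\<^sub>R b V V' p = g p (V p) (V' p) *\<^sub>R b W W p"
          using proportional that W w unfolding a_def by blast
        then have "(1 / a) *\<^sub>R (a *\<^sub>R b V V' p) = g p (V p) (V' p) *\<^sub>R h" by (simp add: h_def)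
        then show ?thesis using a by simp
      qed
      then show ?thesis
        using mean_curvature_vector_eq[of p h] h[OF XY] distributionD(3)[OF D, of p]
        by (simp add: mult.commute)
    qed
  qed
qed

end

section \<open>Conformal change along the distribution\<close>

text \<open>Both \<open>g\<^sub>t(u,v)\<close> and \<open>g\<^sub>t(w,w)\<close> solve \<open>y' = s\<^sub>t(p) y\<close> on the interval \<open>I\<close>, the truncation being
  harmless because \<open>u\<close> and \<open>w\<close> lie in \<open>D\<close>. Their quotient has derivative zero, hence is constant.
  The identity is cross-multiplied so that it also covers \<open>w = 0\<close>.\<close>

lemma conformal_family_ratio_constant:
  assumes split: "\<And>t. t \<in> I \<Longrightarrow> orthogonal_splitting A D E n m (g t)"
    and conf: "conformal_family A D E I g s" and I: "is_interval I" "t \<in> I" "t' \<in> I"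
    and u: "u \<in> D p" and v: "v \<in> tangent_space A p" and w: "w \<in> D p"
  shows "g t p u v * g t' p w w = g t' p u v * g t p w w"
proof (cases "w = 0")
  case True
  interpret t: orthogonal_splitting A D E n m "g t" by (rule split[OF I(2)])
  interpret t': orthogonal_splitting A D E n m "g t'" by (rule split[OF I(3)])
  show ?thesis
    using True t.zero_left[of 0 p] t'.zero_left[of 0 p] subspace_0[OF t.subspace] by simp
next
  case False
  have deriv: "((\<lambda>\<tau>. g \<tau> p x y) has_real_derivative s r p * g r p x y) (at r within I)"
    if r: "r \<in> I" and xy: "x \<in> D p" "y \<in> tangent_space A p" for r x y
  proof -
    interpret r: orthogonal_splitting A D E n m "g r" by (rule split[OF r])
    have "((\<lambda>\<tau>. g \<tau> p x y) has_real_derivative s r p * truncated_metric D E (g r) p x y)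
        (at r within I)"
      using conf r xy distributionD(2)[OF r.D] unfolding conformal_family_def by blast
    then show ?thesis by (simp only: r.truncated_metric_D_left[OF xy])
  qed
  have wT: "w \<in> tangent_space A p" and pos: "r \<in> I \<Longrightarrow> g r p w w > 0" for r
  proof -
    interpret t: orthogonal_splitting A D E n m "g t" by (rule split[OF I(2)])
    show wT: "w \<in> tangent_space A p" using w distributionD(2)[OF t.D] by blast
    assume "r \<in> I"
    then interpret r: orthogonal_splitting A D E n m "g r" by (rule split)
    show "g r p w w > 0" by (rule r.pos[OF wT False])
  qed
  have ratio: "((\<lambda>\<tau>. g \<tau> p u v / g \<tau> p w w) has_real_derivative 0) (at r within I)" if r: "r \<in> I" for r
  proof -
    have "((\<lambda>\<tau>. g \<tau> p u v / g \<tau> p w w) has_real_derivative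
        (s r p * g r p u v * g r p w w - g r p u v * (s r p * g r p w w)) / (g r p w w * g r p w w))
        (at r within I)"
      using pos[OF r] by (intro DERIV_divide deriv r u v w wT) simp
    then show ?thesis by (simp add: mult.commute mult.left_commute)
  qed
  have "\<exists>c. \<forall>r\<in>I. g r p u v / g r p w w = c"
    by (rule has_field_derivative_zero_constant[OF is_interval_convex[OF I(1)] ratio])
  then have "g t p u v / g t p w w = g t' p u v / g t' p w w" using I by auto
  then show ?thesis using pos[OF I(2)] pos[OF I(3)] by (simp add: frac_eq_eq)
qed

text \<open>The pointwise algebra behind \<open>L\<^sub>Z (\<rho> g) = \<rho> L\<^sub>Z g + Z(\<rho>) g\<close>, with \<open>\<rho> = c / a\<close>. Here \<open>a, x\<close> stand
  for \<open>g(W,W), g(X,Y)\<close> and \<open>c, x'\<close> for the same values of the second metric; \<open>da, dx, dc, dx'\<close> are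
  their derivatives along \<open>Z\<close>, and \<open>P, Q, P', Q'\<close> the bracket terms of the Lie derivatives.\<close>

lemma proportionality_transfer:
  fixes a c x x' :: real
  assumes "a \<noteq> 0" "x' * a = x * c" "P' * a = P * c" "Q' * a = Q * c"
    and "x' * da + a * dx' = x * dc + c * dx"
    and "a * (dx + P) = x * (da + Q)"
  shows "c * (dx' + P') = x' * (dc + Q')"
proof -
  have dx': "a * dx' = x * dc + c * dx - x' * da" using assms(5) by linarith
  have "a * a * (c * (dx' + P')) = c * (a * (a * dx')) + c * a * (P' * a)"
    by (simp add: algebra_simps)
  also have "\<dots> = c * (a * (x * dc + c * dx) - (x' * a) * da) + c * a * (P' * a)"
    unfolding dx' by (simp add: algebra_simps)
  also have "\<dots> = c * (c * (a * (dx + P)) + a * x * dc - x * c * da)"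
    unfolding assms(2,3) by (simp add: algebra_simps)
  also have "\<dots> = (x * c) * (a * dc + Q * c)"
    unfolding assms(6) by (simp add: algebra_simps)
  also have "\<dots> = a * a * (x' * (dc + Q'))"
    unfolding assms(2,4)[symmetric] by (simp add: algebra_simps)
  finally have "a * a * (c * (dx' + P')) = a * a * (x' * (dc + Q'))" .
  then show ?thesis using assms(1) by simp
qed

text \<open>The hypothesis \<open>ratio\<close> says that \<open>g' = \<rho> g\<close> on \<open>D \<times> TM\<close>. Its second argument ranges over all
  tangent vectors because the brackets \<open>[X,Z]\<close> need not lie in \<open>D\<close>.\<close>

lemma umbilical_transfer:
  assumes "levi_civita_splitting A D E n m g nabla" "levi_civita_splitting A D E n m g' nabla'"
    and ratio: "\<And>p u v w. u \<in> D p \<Longrightarrow> v \<in> tangent_space A p \<Longrightarrow> w \<in> D p \<Longrightarrow>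
      g' p u v * g p w w = g p u v * g' p w w"
    and umb: "umbilical A D E g nabla"
  shows "umbilical A D E g' nabla'"
proof -
  interpret o: levi_civita_splitting A D E n m g nabla by fact
  interpret t: levi_civita_splitting A D E n m g' nabla' by fact
  show ?thesis unfolding t.umbilical_iff_proportional
  proof (intro ballI allI impI)
    fix X Y W p
    assume XYW: "X \<in> sections A D" "Y \<in> sections A D" "W \<in> sections A D" and W: "W p \<noteq> 0"
    note V = XYW[THEN sections_memD(1)] and mem = XYW[THEN sections_memD(2)]
    have mult_E: "c *\<^sub>R t.b V V' p \<in> E p"
      if "V \<in> sections A D" "V' \<in> sections A D" for V V' c
      using that by (intro subspace_scale distributionD(1)[OF o.E] t.second_fundamental_in_E
          sections_memD(1))
    show "g' p (W p) (W p) *\<^sub>R t.b X Y p = g' p (X p) (Y p) *\<^sub>R t.b W W p"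
    proof (rule t.E_eqI[OF mult_E mult_E])
      fix Z assume Z: "Z \<in> sections A E"
      note ZV = sections_memD(1)[OF Z]
      have smooth: "smooth_fun A UNIV (\<lambda>q. g q (V1 q) (V2 q))"
          "smooth_fun A UNIV (\<lambda>q. g' q (V1 q) (V2 q))"
        if "V1 \<in> vector_fields A" "V2 \<in> vector_fields A" for V1 V2
        by (intro riemannian_metric_smooth o.metric t.metric that)+
      have "(\<lambda>q. g' q (X q) (Y q) * g q (W q) (W q)) = (\<lambda>q. g q (X q) (Y q) * g' q (W q) (W q))"
        by (rule ext) (intro ratio mem vector_field_tangent V)
      then have "app (Z p) (\<lambda>q. g' q (X q) (Y q) * g q (W q) (W q)) =
          app (Z p) (\<lambda>q. g q (X q) (Y q) * g' q (W q) (W q))" by simp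
      \<comment> \<open>Both sides are products of globally smooth functions, so the Leibniz rule at \<open>p\<close> applies to each.\<close>
      then have leibniz:
        "g' p (X p) (Y p) * app (Z p) (\<lambda>q. g q (W q) (W q))
          + g p (W p) (W p) * app (Z p) (\<lambda>q. g' q (X q) (Y q)) =
         g p (X p) (Y p) * app (Z p) (\<lambda>q. g' q (W q) (W q))
          + g' p (W p) (W p) * app (Z p) (\<lambda>q. g q (X q) (Y q))"
        by (simp only: tangent_space_mult[OF vector_field_tangent[OF ZV]] smooth V)
      have bracket: "g' p (V1 p) (lie_bracket V2 Z p) * g p (W p) (W p) =
          g p (V1 p) (lie_bracket V2 Z p) * g' p (W p) (W p)"
        if "V1 \<in> sections A D" "V2 \<in> sections A D" for V1 V2
        by (rule ratio[OF sections_memD(2)[OF that(1)]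
              t.lie_bracket_tangent[OF sections_memD(1)[OF that(2)] ZV] mem(3)])
      have pairing: "g' p (c *\<^sub>R t.b V1 V2 p) (Z p) = c * g' p (t.b V1 V2 p) (Z p)"
          "g p (c *\<^sub>R o.b V1 V2 p) (Z p) = c * g p (o.b V1 V2 p) (Z p)"
        if "V1 \<in> sections A D" "V2 \<in> sections A D" for V1 V2 c
      proof -
        note tangent = distributionD(2)[OF o.E, THEN subsetD] and V12 = that[THEN sections_memD(1)]
        show "g' p (c *\<^sub>R t.b V1 V2 p) (Z p) = c * g' p (t.b V1 V2 p) (Z p)"
          by (rule t.scale_left[OF tangent[OF t.second_fundamental_in_E[OF V12]]
                vector_field_tangent[OF ZV]])
        show "g p (c *\<^sub>R o.b V1 V2 p) (Z p) = c * g p (o.b V1 V2 p) (Z p)"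
          by (rule o.scale_left[OF tangent[OF o.second_fundamental_in_E[OF V12]]
                vector_field_tangent[OF ZV]])
      qed
      have "g p (W p) (W p) *\<^sub>R o.b X Y p = g p (X p) (Y p) *\<^sub>R o.b W W p"
        using umb XYW W unfolding o.umbilical_iff_proportional by blast
      from arg_cong[OF this, of "\<lambda>v. g p v (Z p)"]
      have "g p (W p) (W p) * (2 * g p (o.b X Y p) (Z p)) =
          g p (X p) (Y p) * (2 * g p (o.b W W p) (Z p))"
        unfolding pairing(2)[OF XYW(1,2)] pairing(2)[OF XYW(3,3)] by simp
      then have umb_p:
        "g p (W p) (W p) * (app (Z p) (\<lambda>q. g q (X q) (Y q)) +
          (g p (Y p) (lie_bracket X Z p) + g p (X p) (lie_bracket Y Z p))) =
         g p (X p) (Y p) * (app (Z p) (\<lambda>q. g q (W q) (W q)) +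
          (g p (W p) (lie_bracket W Z p) + g p (W p) (lie_bracket W Z p)))"
        unfolding o.second_fundamental_eq_lie_derivative[OF XYW(1,2) Z]
          o.second_fundamental_eq_lie_derivative[OF XYW(3,3) Z]
        by (simp only: mult_minus_right add.assoc neg_equal_iff_equal)
      have "g' p (W p) (W p) * (app (Z p) (\<lambda>q. g' q (X q) (Y q)) +
          (g' p (Y p) (lie_bracket X Z p) + g' p (X p) (lie_bracket Y Z p))) =
         g' p (X p) (Y p) * (app (Z p) (\<lambda>q. g' q (W q) (W q)) +
          (g' p (W p) (lie_bracket W Z p) + g' p (W p) (lie_bracket W Z p)))"
      proof (rule proportionality_transfer[OF _ _ _ _ leibniz umb_p])
        show "g p (W p) (W p) \<noteq> 0"
          using o.pos[OF vector_field_tangent[OF V(3)] W] by simp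
        show "g' p (X p) (Y p) * g p (W p) (W p) = g p (X p) (Y p) * g' p (W p) (W p)"
          by (intro ratio mem vector_field_tangent V)
      qed (simp_all only: distrib_right bracket XYW)
      then have "g' p (W p) (W p) * (2 * g' p (t.b X Y p) (Z p)) =
          g' p (X p) (Y p) * (2 * g' p (t.b W W p) (Z p))"
        unfolding t.second_fundamental_eq_lie_derivative[OF XYW(1,2) Z]
          t.second_fundamental_eq_lie_derivative[OF XYW(3,3) Z]
        by (simp only: mult_minus_right add.assoc)
      then show "g' p (g' p (W p) (W p) *\<^sub>R t.b X Y p) (Z p) =
          g' p (g' p (X p) (Y p) *\<^sub>R t.b W W p) (Z p)"
        unfolding pairing(1)[OF XYW(1,2)] pairing(1)[OF XYW(3,3)] by simp
    qed (use XYW in auto)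
  qed
qed

theorem proposition2:
  fixes A :: "('m::{t2_space, second_countable_topology}, 'e::euclidean_space) atlas"
    and D D_perp :: "'m \<Rightarrow> 'm functional set"
    and g :: "real \<Rightarrow> 'm metric"
    and nabla :: "real \<Rightarrow> 'm connection"
    and s :: "real \<Rightarrow> 'm \<Rightarrow> real"
    and I :: "real set"
    and n m :: nat
  assumes "smooth_atlas A"
    and "distribution A n D"
    and "distribution A m D_perp"
    and "complementary A D D_perp"
    and "is_interval I" and "0 \<in> I"
    and "smooth_metric_family A I g"
    and "\<And>t. t \<in> I \<Longrightarrow> orthogonal_distributions (g t) D D_perp"
    and "\<And>t. t \<in> I \<Longrightarrow> levi_civita_connection A (g t) (nabla t)"
    and "conformal_family A D D_perp I g s"
    and "umbilical A D D_perp (g 0) (nabla 0)"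
  shows "\<forall>t\<in>I. umbilical A D D_perp (g t) (nabla t)"
proof
  fix t assume t: "t \<in> I"
  have split: "orthogonal_splitting A D D_perp n m (g r)" if "r \<in> I" for r
    using assms(1-4,7) assms(8)[OF that] that
    by unfold_locales (auto simp: smooth_metric_family_def)
  have lc: "levi_civita_splitting A D D_perp n m (g r) (nabla r)" if "r \<in> I" for r
    by (intro levi_civita_splitting.intro levi_civita_splitting_axioms.intro split assms(9) that)
  show "umbilical A D D_perp (g t) (nabla t)"
    by (rule umbilical_transfer[OF lc[OF assms(6)] lc[OF t] _ assms(11)])
      (rule conformal_family_ratio_constant[OF split assms(10,5) t assms(6)])
qed

end
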